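(* Let $\|\cdot\|$ be an admissible norm on $\mathbb{R}^3$ and let $f:M\to(\mathbb{R}^3,\|\cdot\|)$ be an immersed surface whose Minkowski Gaussian curvature is negative (at every point). Then $M$ is a minimal surface if and only if for each domain $D\subseteq M$ and each Birkhoff normal variation of $D$ the associated area function $A(t)$ satisfies $A'(0)=0$.
   Context: A norm $\|\cdot\|$ on $\mathbb{R}^3$ is admissible if its unit sphere $\partial B=\{x\in\mathbb{R}^3:\|x\|=1\}$ has strictly positive Gaussian curvature in the usual Euclidean geometry of $\mathbb{R}^3$. A non-zero vector $v$ is Birkhoff orthogonal to a plane $P$ (through the origin), written $v\dashv_B P$, if $\|v+tw\|\ge\|v\|$ for all $t\in\mathbb{R}$, $w\in P$. Surfaces are smooth and orientable, immersions are smooth, and $M$ is identified with its image under $f$, $T_pM$ being regarded as a plane in $\mathbb{R}^3$. The Birkhoff-Gauss map $\eta:M\to\partial B$ is a globally defined smooth map with $\eta(p)\dashv_B T_pM$ for all $p$ (one of the two choices is fixed). Since $T_{\eta(p)}\partial B$ is parallel to $T_pM$, $d\eta_p$ is an endomorphism of $T_pM$. The Minkowski Gaussian curvature is $K(p)=\det(d\eta_p)$ and the Minkowski mean curvature is $H(p)=\frac12\mathrm{tr}(d\eta_p)$. $M$ is a minimal surface if $H$ vanishes everywhere. The induced area element is the 2-form $\omega(X,Y)=\det[X,Y,\eta]$ on the tangent bundle $TM$, where $\det$ is the usual determinant in $\mathbb{R}^3$, and the area of $M$ is $\int_M\omega$. A domain $D\subseteq M$ is an open, connected subset whose boundary is homeomorphic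 to a sphere; $\bar D$ denotes the union of $D$ with its boundary, and it is assumed that $\bar D\subseteq M$. For any smooth function $g:\bar D\to\mathbb{R}$, the Birkhoff normal variation of $\bar D$ (also called of $D$) with respect to $g$ is the map $F:\bar D\times(-\varepsilon,\varepsilon)\to(\mathbb{R}^3,\|\cdot\|)$, $F(p,t)=F_t(p)=p+tg(p)\eta(p)$. This construction yields a family of immersed surfaces $D_t$ parametrized by $t$; their respective Birkhoff normal vector fields (Birkhoff-Gauss maps) and induced area elements are denoted by $\eta_t$ and $\omega_t$, so that $\omega_t$ evaluated on the images $X^t=(F_t)_*X$, $Y^t=(F_t)_*Y$ of tangent vectors $X,Y$ of $D$ is $\det[X^t,Y^t,\eta_t]$, with $\eta_0=\eta$. The area function, giving the area of $\bar D_t$, is $A(t)=\int_{\bar D}\omega_t$. *)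

theory Defs
  imports "HOL-Analysis.Analysis"
begin

section \<open>Smooth maps between Euclidean spaces\<close>

text \<open>Intended for open \<open>S\<close> only. Differentiating along every fixed vector \<open>v\<close> covers all
  iterated partial derivatives.\<close>

primrec Ck_on :: "nat \<Rightarrow> 'a::euclidean_space set \<Rightarrow> ('a \<Rightarrow> 'b::euclidean_space) \<Rightarrow> bool" where
  "Ck_on 0 S h \<longleftrightarrow> continuous_on S h"
| "Ck_on (Suc k) S h \<longleftrightarrow>
     (\<forall>x\<in>S. h differentiable (at x)) \<and> (\<forall>v. Ck_on k S (\<lambda>x. frechet_derivative h (at x) v))"

definition smooth_on :: "'a::euclidean_space set \<Rightarrow> ('a \<Rightarrow> 'b::euclidean_space) \<Rightarrow> bool" where
  "smooth_on S h \<longleftrightarrow> (\<forall>k. Ck_on k S h)"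


section \<open>Parametrized surfaces in Euclidean 3-space\<close>

text \<open>For a parametrization \<open>r\<close> and a normal field \<open>n\<close> whose differential takes values in the
  tangent plane, the endomorphism \<open>dn\<close> of the tangent plane is represented in the basis
  \<open>\<partial>\<^sub>1r, \<partial>\<^sub>2r\<close> by the matrix \<open>A\<close> with \<open>dn = dr \<circ> A\<close>; it is unique when \<open>dr\<close> is injective. Its
  determinant and trace are those of the endomorphism, hence independent of the parametrization.\<close>

definition normal_diff_matrix ::
    "(real^2 \<Rightarrow> real^3) \<Rightarrow> (real^2 \<Rightarrow> real^3) \<Rightarrow> real^2 \<Rightarrow> real^2^2" where
  "normal_diff_matrix r n u =
     (THE A. \<forall>v. frechet_derivative n (at u) v = frechet_derivative r (at u) (A *v v))"

definition euclidean_normal :: "(real^2 \<Rightarrow> real^3) \<Rightarrow> real^2 \<Rightarrow> real^3" where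
  "euclidean_normal r u =
     sgn (cross3 (frechet_derivative r (at u) (axis 1 1)) (frechet_derivative r (at u) (axis 2 1)))"

definition euclidean_gauss_curvature :: "(real^2 \<Rightarrow> real^3) \<Rightarrow> real^2 \<Rightarrow> real" where
  "euclidean_gauss_curvature r u = det (normal_diff_matrix r (euclidean_normal r) u)"

definition regular_patch :: "(real^3) set \<Rightarrow> (real^2) set \<Rightarrow> (real^2 \<Rightarrow> real^3) \<Rightarrow> bool" where
  "regular_patch S V r \<longleftrightarrow>
     open V \<and> smooth_on V r \<and> (\<forall>u\<in>V. inj (frechet_derivative r (at u))) \<and>
     openin (top_of_set S) (r ` V) \<and> (\<exists>s. homeomorphism V (r ` V) r s)"

text \<open>\<open>S\<close> is a regular (smooth embedded) surface, and its Gaussian curvature, which does not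
  depend on the patch, is positive at every point.\<close>

definition positively_curved_surface :: "(real^3) set \<Rightarrow> bool" where
  "positively_curved_surface S \<longleftrightarrow>
     (\<forall>x\<in>S. \<exists>V r u. regular_patch S V r \<and> u \<in> V \<and> r u = x \<and> 0 < euclidean_gauss_curvature r u)"


section \<open>Admissible norms and Birkhoff orthogonality\<close>

definition is_norm :: "(real^3 \<Rightarrow> real) \<Rightarrow> bool" where
  "is_norm \<nu> \<longleftrightarrow>
     (\<forall>x. 0 \<le> \<nu> x) \<and> (\<forall>x. \<nu> x = 0 \<longleftrightarrow> x = 0) \<and>
     (\<forall>a x. \<nu> (a *\<^sub>R x) = \<bar>a\<bar> * \<nu> x) \<and> (\<forall>x y. \<nu> (x + y) \<le> \<nu> x + \<nu> y)"

definition admissible_norm :: "(real^3 \<Rightarrow> real) \<Rightarrow> bool" where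
  "admissible_norm \<nu> \<longleftrightarrow> is_norm \<nu> \<and> positively_curved_surface {x. \<nu> x = 1}"

definition birkhoff_orthogonal :: "(real^3 \<Rightarrow> real) \<Rightarrow> real^3 \<Rightarrow> (real^3) set \<Rightarrow> bool" where
  "birkhoff_orthogonal \<nu> v P \<longleftrightarrow> v \<noteq> 0 \<and> (\<forall>t. \<forall>w\<in>P. \<nu> v \<le> \<nu> (v + t *\<^sub>R w))"


section \<open>Abstract oriented surfaces\<close>

type_synonym 'm chart = "'m set \<times> ('m \<Rightarrow> real^2)"

definition chart_inv :: "'m chart \<Rightarrow> real^2 \<Rightarrow> 'm" where
  "chart_inv c = inv_into (fst c) (snd c)"

definition is_chart :: "'m topology \<Rightarrow> 'm chart \<Rightarrow> bool" where
  "is_chart T c \<longleftrightarrow>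
     openin T (fst c) \<and> open (snd c ` fst c) \<and>
     homeomorphic_map (subtopology T (fst c)) (top_of_set (snd c ` fst c)) (snd c)"

text \<open>The surface is \<open>topspace T\<close>. An orientable surface is given here by an atlas whose
  transition maps have positive Jacobian determinant; the choice of orientation only enters in the
  integration of 2-forms. It is not tied to the Birkhoff-Gauss map: on a connected domain
  \<open>\<integral>\<omega>\<^sub>t\<close> is the area or, for the opposite choice, minus the area, which is immaterial for the
  vanishing of its derivative.\<close>

definition oriented_surface :: "'m topology \<Rightarrow> 'm chart set \<Rightarrow> bool" where
  "oriented_surface T \<A> \<longleftrightarrow>
     Hausdorff_space T \<and> second_countable T \<and>
     (\<forall>c\<in>\<A>. is_chart T c) \<and> (\<Union>c\<in>\<A>. fst c) = topspace T \<and>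
     (\<forall>c\<in>\<A>. \<forall>d\<in>\<A>. let \<tau> = snd d \<circ> chart_inv c; X = snd c ` (fst c \<inter> fst d) in
        smooth_on X \<tau> \<and> (\<forall>x\<in>X. 0 < det (matrix (frechet_derivative \<tau> (at x)))))"

text \<open>Smoothness on a subset \<open>S\<close> that need not be open means smoothness on an open neighbourhood
  of \<open>S\<close>. If \<open>S\<close> is the closure of an open set, all derivatives on \<open>S\<close> are determined by the values
  on \<open>S\<close>.\<close>

definition smooth_map_on ::
    "'m topology \<Rightarrow> 'm chart set \<Rightarrow> 'm set \<Rightarrow> ('m \<Rightarrow> 'b::euclidean_space) \<Rightarrow> bool" where
  "smooth_map_on T \<A> S h \<longleftrightarrow>
     (\<exists>W. openin T W \<and> S \<subseteq> W \<and> (\<forall>c\<in>\<A>. smooth_on (snd c ` (fst c \<inter> W)) (h \<circ> chart_inv c)))"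

text \<open>Joint smoothness of \<open>(p, t) \<mapsto> E t p\<close> on \<open>S \<times> (-\<epsilon>, \<epsilon>)\<close>.\<close>

definition smooth_family_on ::
    "'m topology \<Rightarrow> 'm chart set \<Rightarrow> 'm set \<Rightarrow> real \<Rightarrow> (real \<Rightarrow> 'm \<Rightarrow> 'b::euclidean_space) \<Rightarrow> bool" where
  "smooth_family_on T \<A> S \<epsilon> E \<longleftrightarrow>
     (\<exists>W. openin T W \<and> S \<subseteq> W \<and>
       (\<forall>c\<in>\<A>. smooth_on ((snd c ` (fst c \<inter> W)) \<times> {-\<epsilon><..<\<epsilon>}) (\<lambda>(x, t). E t (chart_inv c x))))"

definition chart_deriv :: "'m chart \<Rightarrow> ('m \<Rightarrow> 'b::euclidean_space) \<Rightarrow> 'm \<Rightarrow> real^2 \<Rightarrow> 'b" where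
  "chart_deriv c h p = frechet_derivative (h \<circ> chart_inv c) (at (snd c p))"

text \<open>The notions below that are computed in \<open>chart_at \<A> p\<close> do not depend on the chart around
  \<open>p\<close>.\<close>

definition chart_at :: "'m chart set \<Rightarrow> 'm \<Rightarrow> 'm chart" where
  "chart_at \<A> p = (SOME c. c \<in> \<A> \<and> p \<in> fst c)"

definition immersion_on ::
    "'m topology \<Rightarrow> 'm chart set \<Rightarrow> 'm set \<Rightarrow> ('m \<Rightarrow> real^3) \<Rightarrow> bool" where
  "immersion_on T \<A> S h \<longleftrightarrow>
     smooth_map_on T \<A> S h \<and> (\<forall>p\<in>S. inj (chart_deriv (chart_at \<A> p) h p))"

definition tangent_plane :: "'m chart set \<Rightarrow> ('m \<Rightarrow> real^3) \<Rightarrow> 'm \<Rightarrow> (real^3) set" where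
  "tangent_plane \<A> f p = range (chart_deriv (chart_at \<A> p) f p)"


section \<open>Birkhoff-Gauss map and Minkowski curvatures\<close>

definition birkhoff_gauss_map ::
    "(real^3 \<Rightarrow> real) \<Rightarrow> 'm topology \<Rightarrow> 'm chart set \<Rightarrow> 'm set \<Rightarrow> ('m \<Rightarrow> real^3) \<Rightarrow> ('m \<Rightarrow> real^3) \<Rightarrow> bool"
  where
  "birkhoff_gauss_map \<nu> T \<A> S f \<eta> \<longleftrightarrow>
     smooth_map_on T \<A> S \<eta> \<and>
     (\<forall>p\<in>S. \<nu> (\<eta> p) = 1 \<and> birkhoff_orthogonal \<nu> (\<eta> p) (tangent_plane \<A> f p))"

definition gauss_map_matrix ::
    "'m chart set \<Rightarrow> ('m \<Rightarrow> real^3) \<Rightarrow> ('m \<Rightarrow> real^3) \<Rightarrow> 'm \<Rightarrow> real^2^2" where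
  "gauss_map_matrix \<A> f \<eta> p =
     (let c = chart_at \<A> p in normal_diff_matrix (f \<circ> chart_inv c) (\<eta> \<circ> chart_inv c) (snd c p))"

definition minkowski_gauss_curvature ::
    "'m chart set \<Rightarrow> ('m \<Rightarrow> real^3) \<Rightarrow> ('m \<Rightarrow> real^3) \<Rightarrow> 'm \<Rightarrow> real" where
  "minkowski_gauss_curvature \<A> f \<eta> p = det (gauss_map_matrix \<A> f \<eta> p)"

definition minkowski_mean_curvature ::
    "'m chart set \<Rightarrow> ('m \<Rightarrow> real^3) \<Rightarrow> ('m \<Rightarrow> real^3) \<Rightarrow> 'm \<Rightarrow> real" where
  "minkowski_mean_curvature \<A> f \<eta> p = trace (gauss_map_matrix \<A> f \<eta> p) / 2"

definition minimal_surface ::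
    "'m topology \<Rightarrow> 'm chart set \<Rightarrow> ('m \<Rightarrow> real^3) \<Rightarrow> ('m \<Rightarrow> real^3) \<Rightarrow> bool" where
  "minimal_surface T \<A> f \<eta> \<longleftrightarrow> (\<forall>p\<in>topspace T. minkowski_mean_curvature \<A> f \<eta> p = 0)"


section \<open>Integration of 2-forms and the area element\<close>

text \<open>A 2-form is represented by its coefficients \<open>w c p = \<omega>\<^sub>p(\<partial>\<^sub>1, \<partial>\<^sub>2)\<close> in the charts \<open>c\<close>. Its
  integral over a compact set is computed by cutting the set into finitely many Borel pieces, each
  relatively compact in an (oriented) chart domain. By the change of variables formula the result
  does not depend on the partition selected by the choice operator.\<close>

definition chart_partition ::
    "'m topology \<Rightarrow> 'm chart set \<Rightarrow> 'm set \<Rightarrow> nat \<Rightarrow> (nat \<Rightarrow> 'm chart) \<Rightarrow> (nat \<Rightarrow> 'm set) \<Rightarrow> bool" where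
  "chart_partition T \<A> S n c Q \<longleftrightarrow>
     (\<forall>i<n. c i \<in> \<A> \<and> (\<exists>C. compactin T C \<and> Q i \<subseteq> C \<and> C \<subseteq> fst (c i)) \<and>
        snd (c i) ` Q i \<in> sets borel) \<and>
     disjoint_family_on Q {..<n} \<and> (\<Union>i<n. Q i) = S"

definition form_integral ::
    "'m topology \<Rightarrow> 'm chart set \<Rightarrow> 'm set \<Rightarrow> ('m chart \<Rightarrow> 'm \<Rightarrow> real) \<Rightarrow> real" where
  "form_integral T \<A> S w =
     (let (n, c, Q) = (SOME (n, c, Q). chart_partition T \<A> S n c Q) in
       \<Sum>i<n. set_lebesgue_integral lborel (snd (c i) ` Q i) (\<lambda>x. w (c i) (chart_inv (c i) x)))"

definition area_form ::
    "('m \<Rightarrow> real^3) \<Rightarrow> ('m \<Rightarrow> real^3) \<Rightarrow> 'm chart \<Rightarrow> 'm \<Rightarrow> real" where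
  "area_form f \<eta> c p =
     det (vector [chart_deriv c f p (axis 1 1), chart_deriv c f p (axis 2 1), \<eta> p] :: real^3^3)"


section \<open>Domains, Birkhoff normal variations and the area function\<close>

text \<open>The boundary of a domain of a surface is one-dimensional, so the sphere is a circle.
  Compactness of the closure excludes unbounded domains such as the exterior of a disc, which
  have no (finite) area.\<close>

definition surface_domain :: "'m topology \<Rightarrow> 'm set \<Rightarrow> bool" where
  "surface_domain T D \<longleftrightarrow>
     openin T D \<and> connectedin T D \<and> compactin T (T closure_of D) \<and>
     subtopology T (T frontier_of D) homeomorphic_space top_of_set (sphere (0::real^2) 1)"

definition variation_map ::
    "('m \<Rightarrow> real^3) \<Rightarrow> ('m \<Rightarrow> real^3) \<Rightarrow> ('m \<Rightarrow> real) \<Rightarrow> real \<Rightarrow> 'm \<Rightarrow> real^3" where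
  "variation_map f \<eta> g t p = f p + (t * g p) *\<^sub>R \<eta> p"

text \<open>The family \<open>E\<close> consists of the Birkhoff-Gauss maps \<open>\<eta>\<^sub>t\<close> of the surfaces \<open>D\<^sub>t\<close>. Pointwise
  these are determined up to sign only; the sign is fixed by \<open>\<eta>\<^sub>0 = \<eta>\<close> and smoothness in \<open>(p, t)\<close>.\<close>

definition birkhoff_normal_variation ::
    "(real^3 \<Rightarrow> real) \<Rightarrow> 'm topology \<Rightarrow> 'm chart set \<Rightarrow> ('m \<Rightarrow> real^3) \<Rightarrow> ('m \<Rightarrow> real^3) \<Rightarrow>
     'm set \<Rightarrow> ('m \<Rightarrow> real) \<Rightarrow> real \<Rightarrow> (real \<Rightarrow> 'm \<Rightarrow> real^3) \<Rightarrow> bool" where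
  "birkhoff_normal_variation \<nu> T \<A> f \<eta> D g \<epsilon> E \<longleftrightarrow>
     0 < \<epsilon> \<and> smooth_map_on T \<A> (T closure_of D) g \<and>
     (\<forall>t\<in>{-\<epsilon><..<\<epsilon>}.
        immersion_on T \<A> (T closure_of D) (variation_map f \<eta> g t) \<and>
        birkhoff_gauss_map \<nu> T \<A> (T closure_of D) (variation_map f \<eta> g t) (E t)) \<and>
     smooth_family_on T \<A> (T closure_of D) \<epsilon> E \<and>
     (\<forall>p\<in>T closure_of D. E 0 p = \<eta> p)"

definition area_function ::
    "'m topology \<Rightarrow> 'm chart set \<Rightarrow> ('m \<Rightarrow> real^3) \<Rightarrow> ('m \<Rightarrow> real^3) \<Rightarrow>
     'm set \<Rightarrow> ('m \<Rightarrow> real) \<Rightarrow> (real \<Rightarrow> 'm \<Rightarrow> real^3) \<Rightarrow> real \<Rightarrow> real" where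
  "area_function T \<A> f \<eta> D g E t =
     form_integral T \<A> (T closure_of D) (area_form (variation_map f \<eta> g t) (E t))"

end

theory Submission
  imports Defs
begin

text \<open>The theorem follows from the first variation formula \<open>A'(0) = \<integral> 2 H g \<omega>\<close> over the closure of the
  domain (\<open>first_variation\<close>), valid for every Birkhoff normal variation.

  Its geometric core is that a unit vector \<open>\<eta>\<close> which is Birkhoff orthogonal to a plane \<open>P\<close> lies on a plane
  parallel to \<open>P\<close> that supports the unit ball (\<open>birkhoff_orthogonal_normal_bound\<close>). A differentiable
  family of unit vectors through \<open>\<eta>\<close> stays on one side of this plane and so has its derivative in \<open>P\<close>
  (\<open>normal_derivative_tangent\<close>). Applied along the surface, this says that \<open>d\<eta>\<close> is an endomorphism of
  the tangent plane; applied in time, it says that \<open>\<partial>\<^sub>t\<eta>\<^sub>t\<close> is tangent at \<open>t = 0\<close>. Hence in the derivative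
  of \<open>det[\<partial>\<^sub>1F\<^sub>t, \<partial>\<^sub>2F\<^sub>t, \<eta>\<^sub>t]\<close> the motion of the normal contributes nothing, and the motion of the points
  contributes \<open>g tr(d\<eta>) \<omega> = 2 H g \<omega>\<close> (\<open>cross3_trace\<close>).

  If \<open>H = 0\<close>, the formula gives \<open>A'(0) = 0\<close>. Conversely, suppose that \<open>H(p) \<noteq> 0\<close>. Choose a closed
  coordinate disc around \<open>p\<close> on which \<open>H \<omega>\<close> has constant sign, and take for \<open>g\<close> this sign as a constant
  function. The varied surfaces \<open>f + t g \<eta>\<close> are then parallel surfaces: they have the same tangent planes
  as \<open>f\<close>, so that \<open>\<eta>\<^sub>t = \<eta>\<close> is their Birkhoff-Gauss map (\<open>parallel_variation\<close>), and they are immersed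
  for small \<open>t\<close> by compactness. The integrand of the first variation is positive in every chart of
  the oriented atlas, so \<open>A'(0) > 0\<close> (\<open>form_integral_pos\<close>).\<close>

section \<open>Linear parametrizations of planes in 3-space\<close>

lemma plane_vec_expand:
  fixes v :: "real^2"
  shows "v = v $ 1 *\<^sub>R axis 1 1 + v $ 2 *\<^sub>R axis 2 1"
  by (simp add: vec_eq_iff forall_2 axis_def)

lemma linear_plane_expand:
  fixes B :: "real^2 \<Rightarrow> 'a::real_vector"
  assumes "linear B"
  shows "B v = v $ 1 *\<^sub>R B (axis 1 1) + v $ 2 *\<^sub>R B (axis 2 1)"
  by (subst plane_vec_expand[of v]) (simp only: linear_add[OF assms] linear_scale[OF assms])

lemma cross3_linear_images:
  fixes B :: "real^2 \<Rightarrow> real^3"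
  assumes "linear B"
  shows "cross3 (B v) (B w) =
    (v $ 1 * w $ 2 - v $ 2 * w $ 1) *\<^sub>R cross3 (B (axis 1 1)) (B (axis 2 1))"
proof -
  have "cross3 (a *\<^sub>R x + b *\<^sub>R y) (c *\<^sub>R x + d *\<^sub>R y) = (a * d - b * c) *\<^sub>R cross3 x y"
    for a b c d :: real and x y
    by (simp add: cross3_simps forall_3)
  then show ?thesis
    unfolding linear_plane_expand[OF assms, of v] linear_plane_expand[OF assms, of w] .
qed

text \<open>This is where the mean curvature will enter the first variation: an alternating bilinear map on a
  plane is a multiple of the determinant, and the derivative of the determinant at the identity is
  the trace.\<close>

lemma cross3_trace:
  fixes B :: "real^2 \<Rightarrow> real^3"
  assumes "linear B"
  shows "cross3 (B (A *v v)) (B w) + cross3 (B v) (B (A *v w)) = trace A *\<^sub>R cross3 (B v) (B w)"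
proof -
  let ?n = "cross3 (B (axis 1 1)) (B (axis 2 1))"
  have "cross3 (B (A *v v)) (B w) + cross3 (B v) (B (A *v w)) =
     (((A *v v) $ 1 * w $ 2 - (A *v v) $ 2 * w $ 1) + (v $ 1 * (A *v w) $ 2 - v $ 2 * (A *v w) $ 1)) *\<^sub>R ?n"
    by (simp add: cross3_linear_images[OF assms, of "A *v v"] cross3_linear_images[OF assms, of _ "A *v w"] scaleR_add_left)
  also have "\<dots> = (trace A * (v $ 1 * w $ 2 - v $ 2 * w $ 1)) *\<^sub>R ?n"
    by (rule arg_cong[where f = "\<lambda>x. x *\<^sub>R _"])
       (simp add: matrix_vector_mult_def trace_def sum_2 algebra_simps)
  finally show ?thesis
    by (simp add: cross3_linear_images[OF assms, of v])
qed

lemma cross3_nonzero_iff_inj: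
  fixes B :: "real^2 \<Rightarrow> real^3"
  assumes "linear B"
  shows "cross3 (B (axis 1 1)) (B (axis 2 1)) \<noteq> 0 \<longleftrightarrow> inj B"
proof
  assume n: "cross3 (B (axis 1 1)) (B (axis 2 1)) \<noteq> 0"
  show "inj B"
    unfolding linear_injective_0[OF assms]
  proof (intro allI impI)
    fix v assume v: "B v = 0"
    have "v $ 1 *\<^sub>R cross3 (B (axis 1 1)) (B (axis 2 1)) = cross3 (B v) (B (axis 2 1))"
      "v $ 2 *\<^sub>R cross3 (B (axis 1 1)) (B (axis 2 1)) = cross3 (B (axis 1 1)) (B v)"
      by (simp_all add: cross3_linear_images[OF assms, of v] cross3_linear_images[OF assms, of _ v] axis_def)
    with n have "v $ 1 = 0" "v $ 2 = 0"
      by (simp_all only: v cross_zero_left cross_zero_right scaleR_eq_0_iff simp_thms)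
    then show "v = 0" by (simp add: vec_eq_iff forall_2)
  qed
next
  assume inj: "inj B"
  show "cross3 (B (axis 1 1)) (B (axis 2 1)) \<noteq> 0"
  proof
    assume "cross3 (B (axis 1 1)) (B (axis 2 1)) = 0"
    then consider "B (axis 1 1) = 0" | "B (axis 2 1) = 0" | c where "B (axis 2 1) = c *\<^sub>R B (axis 1 1)"
      by (auto simp: cross_eq_0 collinear_lemma)
    then obtain v :: "real^2" where "v \<noteq> 0" "B v = 0"
    proof cases
      case 1 then show ?thesis using that[of "axis 1 1"] by (simp add: axis_eq_0_iff)
    next
      case 2 then show ?thesis using that[of "axis 2 1"] by (simp add: axis_eq_0_iff)
    next
      case 3
      show ?thesis
      proof (rule that)
        show "axis 2 1 - c *\<^sub>R axis 1 1 \<noteq> (0 :: real^2)"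
          by (simp add: vec_eq_iff forall_2 axis_def)
        show "B (axis 2 1 - c *\<^sub>R axis 1 1) = 0"
          using 3 by (simp add: linear_diff[OF assms] linear_scale[OF assms])
      qed
    qed
    then show False using inj linear_injective_0[OF assms] by blast
  qed
qed

lemma range_eq_cross3_orthogonal:
  fixes B :: "real^2 \<Rightarrow> real^3"
  assumes B: "linear B" and inj: "inj B"
  shows "x \<in> range B \<longleftrightarrow> cross3 (B (axis 1 1)) (B (axis 2 1)) \<bullet> x = 0"
proof
  assume "x \<in> range B"
  then obtain v where "x = B v" by blast
  then have "x = v $ 1 *\<^sub>R B (axis 1 1) + v $ 2 *\<^sub>R B (axis 2 1)"
    using linear_plane_expand[OF B] by blast
  then show "cross3 (B (axis 1 1)) (B (axis 2 1)) \<bullet> x = 0"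
    by (simp add: inner_right_distrib dot_cross_self)
next
  let ?a = "B (axis 1 1)" and ?b = "B (axis 2 1)"
  let ?n = "cross3 ?a ?b"
  assume x: "?n \<bullet> x = 0"
  \<comment> \<open>expansion of \<open>x\<close> in the basis \<open>a, b, a \<times> b\<close> by Cramer's rule\<close>
  have id: "(cross3 a b \<bullet> cross3 a b) *\<^sub>R x =
     (x \<bullet> cross3 b (cross3 a b)) *\<^sub>R a + (x \<bullet> cross3 (cross3 a b) a) *\<^sub>R b + (cross3 a b \<bullet> x) *\<^sub>R cross3 a b"
    for a b x
    unfolding vec_eq_iff forall_3 by (simp add: inner_vec_def sum_3 cross3_def) algebra
  define r where "r = ?n \<bullet> ?n"
  have r: "r \<noteq> 0"
    using inj cross3_nonzero_iff_inj[OF B] by (simp add: r_def)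
  define p q where "p = x \<bullet> cross3 ?b ?n" and "q = x \<bullet> cross3 ?n ?a"
  have "r *\<^sub>R x = p *\<^sub>R ?a + q *\<^sub>R ?b"
    using id[of ?a ?b x] x by (simp add: r_def p_def q_def)
  also have "\<dots> = B (p *\<^sub>R axis 1 1 + q *\<^sub>R axis 2 1)"
    by (simp add: linear_add[OF B] linear_scale[OF B])
  finally have "x = B ((1 / r) *\<^sub>R (p *\<^sub>R axis 1 1 + q *\<^sub>R axis 2 1))"
    using r unfolding linear_scale[OF B] by (metis (no_types) divide_inverse mult.left_neutral scaleR_scaleR left_inverse scaleR_one)
  then show "x \<in> range B" by blast
qed

section \<open>Birkhoff normals and supporting planes\<close>

text \<open>If \<open>y\<close> is a unit vector that is Birkhoff orthogonal to the plane with Euclidean normal \<open>n\<close>, then the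
  plane through \<open>y\<close> parallel to it supports the unit ball. The linear form \<open>n \<bullet> x / n \<bullet> y\<close>, which is 1 on
  this plane, is therefore bounded by the norm.\<close>

lemma birkhoff_orthogonal_normal_bound:
  fixes B :: "real^2 \<Rightarrow> real^3"
  assumes norm: "is_norm \<nu>" and B: "linear B" "inj B"
    and orth: "birkhoff_orthogonal \<nu> y (range B)" and "\<nu> y = 1"
  defines "n \<equiv> cross3 (B (axis 1 1)) (B (axis 2 1))"
  shows "n \<bullet> y \<noteq> 0" and "\<bar>n \<bullet> x\<bar> \<le> \<bar>n \<bullet> y\<bar> * \<nu> x"
proof -
  have hom: "\<nu> (a *\<^sub>R x) = \<bar>a\<bar> * \<nu> x" for a x using norm by (auto simp: is_norm_def)
  have nz: "\<nu> x \<ge> 0" for x using norm by (auto simp: is_norm_def)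
  have ge: "\<nu> (y + w) \<ge> 1" if "n \<bullet> w = 0" for w
  proof -
    have "w \<in> range B" using range_eq_cross3_orthogonal[OF B] that by (simp add: n_def)
    then have "\<nu> y \<le> \<nu> (y + 1 *\<^sub>R w)" using orth unfolding birkhoff_orthogonal_def by blast
    then show ?thesis using \<open>\<nu> y = 1\<close> by simp
  qed
  show ny: "n \<bullet> y \<noteq> 0"
    using ge[of "- y"] hom[of 0 0] by auto
  show "\<bar>n \<bullet> x\<bar> \<le> \<bar>n \<bullet> y\<bar> * \<nu> x"
  proof (cases "n \<bullet> x = 0")
    case True then show ?thesis by (simp add: nz)
  next
    case False
    define s where "s = (n \<bullet> x) / (n \<bullet> y)"
    have "s \<noteq> 0" using False ny by (simp add: s_def)
    have "n \<bullet> ((1 / s) *\<^sub>R x - y) = 0"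
      using False ny by (simp add: s_def inner_diff_right)
    from ge[OF this] have "1 \<le> \<bar>1 / s\<bar> * \<nu> x" by (simp add: hom)
    then have "\<bar>s\<bar> \<le> \<nu> x" using \<open>s \<noteq> 0\<close> by (simp add: field_simps)
    then show ?thesis using ny by (simp add: s_def field_simps)
  qed
qed

text \<open>A family of unit vectors that passes through a Birkhoff normal of a plane moves parallel to this
  plane to first order: the supporting linear form attains an extremum over the family there. The
  lemma is used twice, for \<open>e = \<eta>\<close> on the surface and for the time dependence \<open>e = \<eta>\<^sub>t(p)\<close> at a fixed
  point.\<close>

lemma normal_derivative_tangent:
  fixes B :: "real^2 \<Rightarrow> real^3" and e :: "'a::euclidean_space \<Rightarrow> real^3"
  assumes norm: "is_norm \<nu>" and B: "linear B" "inj B"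
    and orth: "birkhoff_orthogonal \<nu> (e x) (range B)"
    and U: "open U" "x \<in> U" "\<And>y. y \<in> U \<Longrightarrow> \<nu> (e y) = 1"
    and e': "(e has_derivative e') (at x)"
  shows "e' v \<in> range B"
proof -
  define n where "n = cross3 (B (axis 1 1)) (B (axis 2 1))"
  note bound = birkhoff_orthogonal_normal_bound[OF norm B orth U(3)[OF U(2)], folded n_def]
  have "((\<lambda>y. n \<bullet> e y) has_derivative (\<lambda>v. n \<bullet> e' v)) (at x)"
    by (intro derivative_intros e')
  moreover have "(\<forall>y\<in>U. n \<bullet> e y \<le> n \<bullet> e x) \<or> (\<forall>y\<in>U. n \<bullet> e x \<le> n \<bullet> e y)"
  proof -
    have "\<bar>n \<bullet> e y\<bar> \<le> \<bar>n \<bullet> e x\<bar>" if "y \<in> U" for y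
      using bound(2)[of "e y"] U(3)[OF that] by simp
    then show ?thesis by (cases "0 \<le> n \<bullet> e x") force+
  qed
  ultimately have "(\<lambda>v. n \<bullet> e' v) = (\<lambda>v. 0)"
    using differential_zero_maxmin[OF U(2,1)] by blast
  then show ?thesis
    unfolding range_eq_cross3_orthogonal[OF B] n_def[symmetric] by meson
qed

section \<open>Smooth maps between Euclidean spaces\<close>

lemma Ck_on_cong:
  assumes "open S" "\<And>x. x \<in> S \<Longrightarrow> g x = h x" "Ck_on k S g"
  shows "Ck_on k S h"
  using assms(2,3)
proof (induction k arbitrary: g h)
  case 0
  then show ?case by (metis Ck_on.simps(1) continuous_on_cong)
next
  case (Suc k)
  have hg: "(h has_derivative frechet_derivative g (at x)) (at x)" if "x \<in> S" for x
    using Suc.prems that assms(1)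
    by (metis Ck_on.simps(2) frechet_derivative_works has_derivative_transform_within_open)
  then have h: "h differentiable (at x)" "frechet_derivative g (at x) v = frechet_derivative h (at x) v"
    if "x \<in> S" for x v
    using hg[OF that] frechet_derivative_at[OF hg[OF that]] by (simp_all add: differentiable_def, blast)
  have "Ck_on k S (\<lambda>x. frechet_derivative h (at x) v)" for v
    using Suc.IH[OF h(2)] Suc.prems(2) by auto
  with h(1) show ?case by simp
qed

lemma Ck_on_add_scaleR:
  assumes "open S" "Ck_on k S g" "Ck_on k S h"
  shows "Ck_on k S (\<lambda>x. g x + a *\<^sub>R h x)"
  using assms(2,3)
proof (induction k arbitrary: g h)
  case 0
  then show ?case by (auto intro!: continuous_intros)
next
  case (Suc k)
  have d: "((\<lambda>x. g x + a *\<^sub>R h x) has_derivative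
     (\<lambda>v. frechet_derivative g (at x) v + a *\<^sub>R frechet_derivative h (at x) v)) (at x)" if "x \<in> S" for x
    using Suc.prems that by (auto intro!: derivative_intros simp: frechet_derivative_works[symmetric])
  have "Ck_on k S (\<lambda>x. frechet_derivative (\<lambda>x. g x + a *\<^sub>R h x) (at x) v)" for v
  proof (rule Ck_on_cong[OF assms(1)])
    show "Ck_on k S (\<lambda>x. frechet_derivative g (at x) v + a *\<^sub>R frechet_derivative h (at x) v)"
      using Suc.IH Suc.prems by simp
  qed (simp add: frechet_derivative_at[OF d, symmetric])
  with d show ?case unfolding Ck_on.simps differentiable_def by blast
qed

lemma Ck_on_const: "open S \<Longrightarrow> Ck_on k S (\<lambda>_. a)"
proof (induction k arbitrary: a)
  case (Suc k)
  then show ?case by (simp add: frechet_derivative_const)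
qed simp

text \<open>Turns a field on the surface into a smooth family that is constant in time.\<close>

lemma Ck_on_fst:
  assumes "open X" "open Y" "Ck_on k X h"
  shows "Ck_on k (X \<times> Y) (\<lambda>(x, y). h x)"
  using assms(3)
proof (induction k arbitrary: h)
  case 0
  then show ?case
    by (auto simp: case_prod_unfold intro!: continuous_on_compose2[of X h] continuous_intros)
next
  case (Suc k)
  have d: "((\<lambda>(x, y). h x) has_derivative (\<lambda>v. frechet_derivative h (at (fst p)) (fst v))) (at p)"
    if "p \<in> X \<times> Y" for p
    using Suc.prems that unfolding case_prod_unfold
    by (intro has_derivative_compose[of fst fst, OF has_derivative_fst[OF has_derivative_ident]])
       (auto simp: frechet_derivative_works[symmetric])
  have fr: "frechet_derivative (\<lambda>(x, y). h x) (at p) = (\<lambda>v. frechet_derivative h (at (fst p)) (fst v))"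
    if "p \<in> X \<times> Y" for p
    by (rule frechet_derivative_at[OF d[OF that], symmetric])
  have "Ck_on k (X \<times> Y) (\<lambda>p. frechet_derivative (\<lambda>(x, y). h x) (at p) v)" for v
  proof (rule Ck_on_cong)
    show "open (X \<times> Y)" using assms by (simp add: open_Times)
    show "Ck_on k (X \<times> Y) (\<lambda>(x, y). frechet_derivative h (at x) (fst v))"
      using Suc.IH Suc.prems by simp
  qed (simp add: fr case_prod_beta)
  with d show ?case unfolding Ck_on.simps differentiable_def by blast
qed

lemma smooth_on_imp_continuous_on: "smooth_on S h \<Longrightarrow> continuous_on S h"
  by (metis Ck_on.simps(1) smooth_on_def)

lemma smooth_on_has_derivative:
  "smooth_on S h \<Longrightarrow> x \<in> S \<Longrightarrow> (h has_derivative frechet_derivative h (at x)) (at x)"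
  by (metis Ck_on.simps(2) smooth_on_def frechet_derivative_works)

lemma smooth_on_continuous_derivative:
  "smooth_on S h \<Longrightarrow> continuous_on S (\<lambda>x. frechet_derivative h (at x) v)"
  by (metis Ck_on.simps smooth_on_def)

section \<open>Charts\<close>

context
  fixes T :: "'m topology" and c :: "'m chart"
  assumes c: "is_chart T c"
begin

lemma chart_domain: "openin T (fst c)" "fst c \<subseteq> topspace T"
  using c openin_subset by (auto simp: is_chart_def)

lemma chart_image_open: "open (snd c ` fst c)"
  using c by (auto simp: is_chart_def)

lemma chart_homeomorphic_map:
  "homeomorphic_map (subtopology T (fst c)) (top_of_set (snd c ` fst c)) (snd c)"
  using c by (auto simp: is_chart_def)

lemma chart_inj: "inj_on (snd c) (fst c)"
  using homeomorphic_imp_injective_map[OF chart_homeomorphic_map] chart_domain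
  by (simp add: inf.absorb2)

lemma chart_inv_chart: "p \<in> fst c \<Longrightarrow> chart_inv c (snd c p) = p"
  by (simp add: chart_inv_def chart_inj)

lemma chart_chart_inv: "x \<in> snd c ` fst c \<Longrightarrow> snd c (chart_inv c x) = x"
  by (simp add: chart_inv_def f_inv_into_f)

lemma chart_inv_mem: "x \<in> snd c ` fst c \<Longrightarrow> chart_inv c x \<in> fst c"
  by (simp add: chart_inv_def inv_into_into)

lemma chart_image_Int: "x \<in> snd c ` (fst c \<inter> W) \<longleftrightarrow> x \<in> snd c ` fst c \<and> chart_inv c x \<in> W"
  using chart_inv_chart chart_chart_inv chart_inv_mem by force

lemma chart_inv_in_Int: "x \<in> snd c ` (fst c \<inter> W) \<Longrightarrow> chart_inv c x \<in> fst c \<inter> W"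
  using chart_inv_chart by auto

lemma open_chart_image:
  assumes "openin T W"
  shows "open (snd c ` (fst c \<inter> W))"
proof -
  have "openin (subtopology T (fst c)) (fst c \<inter> W)"
    using assms by (metis inf_commute openin_subtopology)
  then have "openin (top_of_set (snd c ` fst c)) (snd c ` (fst c \<inter> W))"
    using homeomorphic_imp_open_map[OF chart_homeomorphic_map] by (simp add: open_map_def)
  then show ?thesis
    using chart_image_open openin_open_trans by blast
qed

lemma compact_chart_image:
  assumes "compactin T C" "C \<subseteq> fst c"
  shows "compact (snd c ` C)"
proof -
  have "compactin (top_of_set (snd c ` fst c)) (snd c ` C)"
    using homeomorphic_map_compactness[OF chart_homeomorphic_map, of C] assms chart_domain
    by (simp add: compactin_subtopology)
  then show ?thesis by (simp add: compactin_subtopology)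
qed

lemma chart_inv_homeomorphic_map:
  "homeomorphic_map (top_of_set (snd c ` fst c)) (subtopology T (fst c)) (chart_inv c)"
proof -
  obtain g where g: "homeomorphic_maps (subtopology T (fst c)) (top_of_set (snd c ` fst c)) (snd c) g"
    using chart_homeomorphic_map homeomorphic_map_maps by blast
  then have "homeomorphic_map (top_of_set (snd c ` fst c)) (subtopology T (fst c)) g"
    using homeomorphic_maps_map by blast
  moreover have "g x = chart_inv c x" if "x \<in> topspace (top_of_set (snd c ` fst c))" for x
    using that g chart_domain chart_inv_chart by (force simp: homeomorphic_maps_def)
  ultimately show ?thesis by (rule homeomorphic_map_eq)
qed

lemma chart_inv_continuous_map: "continuous_map (top_of_set (snd c ` fst c)) T (chart_inv c)"
  using homeomorphic_imp_continuous_map[OF chart_inv_homeomorphic_map]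
  by (simp add: continuous_map_in_subtopology)

lemma compactin_chart_inv_image:
  assumes "compact X" "X \<subseteq> snd c ` fst c"
  shows "compactin T (chart_inv c ` X)"
  using assms by (intro image_compactin[OF _ chart_inv_continuous_map]) (simp add: compactin_subtopology)

lemma openin_chart_inv_image:
  assumes "open X" "X \<subseteq> snd c ` fst c"
  shows "openin T (chart_inv c ` X)"
proof -
  have "openin (top_of_set (snd c ` fst c)) X"
    using assms by (simp add: open_subset)
  then have "openin (subtopology T (fst c)) (chart_inv c ` X)"
    using homeomorphic_imp_open_map[OF chart_inv_homeomorphic_map] by (simp add: open_map_def)
  then show ?thesis using chart_domain openin_trans_full by blast
qed

end

lemma oriented_surface_chart: "oriented_surface T \<A> \<Longrightarrow> c \<in> \<A> \<Longrightarrow> is_chart T c"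
  by (simp add: oriented_surface_def)

lemma chart_at:
  assumes "oriented_surface T \<A>" "p \<in> topspace T"
  shows "chart_at \<A> p \<in> \<A>" "p \<in> fst (chart_at \<A> p)"
proof -
  have "(\<Union>c\<in>\<A>. fst c) = topspace T" using assms(1) by (simp add: oriented_surface_def)
  then have "\<exists>c. c \<in> \<A> \<and> p \<in> fst c" using assms(2) by blast
  then have "chart_at \<A> p \<in> \<A> \<and> p \<in> fst (chart_at \<A> p)"
    unfolding chart_at_def by (rule someI_ex)
  then show "chart_at \<A> p \<in> \<A>" "p \<in> fst (chart_at \<A> p)" by auto
qed

definition transition_deriv :: "'m chart \<Rightarrow> 'm chart \<Rightarrow> 'm \<Rightarrow> real^2 \<Rightarrow> real^2" where
  "transition_deriv c d p = chart_deriv c (snd d) p"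

lemma transition_deriv:
  assumes "oriented_surface T \<A>" "c \<in> \<A>" "d \<in> \<A>" "p \<in> fst c" "p \<in> fst d"
  shows "(snd d \<circ> chart_inv c has_derivative transition_deriv c d p) (at (snd c p))"
    and "0 < det (matrix (transition_deriv c d p))"
proof -
  let ?X = "snd c ` (fst c \<inter> fst d)"
  have "smooth_on ?X (snd d \<circ> chart_inv c)"
    and pos: "\<forall>x\<in>?X. 0 < det (matrix (frechet_derivative (snd d \<circ> chart_inv c) (at x)))"
    using assms(1-3) unfolding oriented_surface_def Let_def by blast+
  moreover have "snd c p \<in> ?X" using assms by blast
  ultimately show "(snd d \<circ> chart_inv c has_derivative transition_deriv c d p) (at (snd c p))"
    "0 < det (matrix (transition_deriv c d p))"
    unfolding transition_deriv_def chart_deriv_def using smooth_on_has_derivative by blast+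
qed

lemma chart_deriv_transition:
  fixes h :: "'m \<Rightarrow> 'b::euclidean_space"
  assumes S: "oriented_surface T \<A>" and cd: "c \<in> \<A>" "d \<in> \<A>" "p \<in> fst c" "p \<in> fst d"
    and h: "(h \<circ> chart_inv d) differentiable (at (snd d p))"
  shows "(h \<circ> chart_inv c has_derivative chart_deriv d h p \<circ> transition_deriv c d p) (at (snd c p))"
    and "chart_deriv c h p = chart_deriv d h p \<circ> transition_deriv c d p"
proof -
  let ?X = "snd c ` (fst c \<inter> fst d)"
  note charts = oriented_surface_chart[OF S cd(1)] oriented_surface_chart[OF S cd(2)]
  have "((h \<circ> chart_inv d) \<circ> (snd d \<circ> chart_inv c) has_derivative
      chart_deriv d h p \<circ> transition_deriv c d p) (at (snd c p))"
  proof (rule diff_chain_at[OF transition_deriv(1)[OF S cd]])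
    have "(snd d \<circ> chart_inv c) (snd c p) = snd d p"
      using chart_inv_chart[OF charts(1)] cd by simp
    then show "(h \<circ> chart_inv d has_derivative chart_deriv d h p) (at ((snd d \<circ> chart_inv c) (snd c p)))"
      using h by (simp only: chart_deriv_def frechet_derivative_works)
  qed
  moreover have "open ?X" using open_chart_image[OF charts(1)] chart_domain[OF charts(2)] by blast
  moreover have "snd c p \<in> ?X" using cd by blast
  moreover have "((h \<circ> chart_inv d) \<circ> (snd d \<circ> chart_inv c)) x = (h \<circ> chart_inv c) x" if "x \<in> ?X" for x
    using that chart_inv_chart[OF charts(2)] by (simp add: chart_image_Int[OF charts(1)])
  ultimately show "(h \<circ> chart_inv c has_derivative chart_deriv d h p \<circ> transition_deriv c d p) (at (snd c p))"
    by (rule has_derivative_transform_within_open)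
  from frechet_derivative_at[OF this]
  show "chart_deriv c h p = chart_deriv d h p \<circ> transition_deriv c d p"
    unfolding chart_deriv_def by (rule sym)
qed

section \<open>Integrals of 2-forms over compact sets\<close>

lemma set_integrable_subset_compact:
  fixes h :: "'a::euclidean_space \<Rightarrow> real"
  assumes "compact K" "B \<in> sets borel" "B \<subseteq> K" "continuous_on K h"
  shows "set_integrable lborel B h"
proof (rule set_integrable_subset)
  show "set_integrable lborel K h"
    using borel_integrable_compact[OF assms(1,4)] by (simp add: set_integrable_def)
qed (use assms in simp_all)

text \<open>Differentiation under the integral sign. On a compact set the \<open>t\<close>-derivative is uniformly
  continuous, so by the mean value theorem the difference quotients converge uniformly, and the
  domain of integration has finite measure.\<close>

lemma has_real_derivative_set_lebesgue_integral:
  fixes a a' :: "real \<Rightarrow> 'a::euclidean_space \<Rightarrow> real"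
  assumes K: "compact K" "B \<in> sets borel" "B \<subseteq> K" and "0 < \<epsilon>"
    and deriv: "\<And>x t. x \<in> K \<Longrightarrow> \<bar>t\<bar> < \<epsilon> \<Longrightarrow> ((\<lambda>t. a t x) has_real_derivative a' t x) (at t)"
    and cont: "\<And>t. \<bar>t\<bar> < \<epsilon> \<Longrightarrow> continuous_on K (a t)"
    and cont': "continuous_on (K \<times> {-\<epsilon><..<\<epsilon>}) (\<lambda>(x, t). a' t x)"
  shows "((\<lambda>t. set_lebesgue_integral lborel B (a t)) has_real_derivative
           set_lebesgue_integral lborel B (a' 0)) (at 0)"
proof -
  have "continuous_on K (\<lambda>x. (\<lambda>(x, t). a' t x) (x, 0))"
    using \<open>0 < \<epsilon>\<close> by (intro continuous_on_compose2[OF cont'] continuous_intros) auto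
  then have cont0: "continuous_on K (a' 0)" by simp
  note integrable = set_integrable_subset_compact[OF K]
  have B: "B \<in> sets lborel" "emeasure lborel B \<noteq> \<infinity>"
    using K emeasure_compact_finite[OF K(1)] emeasure_mono[OF K(3), of lborel] borel_compact[OF K(1)]
    by (auto simp: top.extremum_strict top_unique)
  have unif: "uniformly_continuous_on (K \<times> {-\<epsilon>/2..\<epsilon>/2}) (\<lambda>(x, t). a' t x)"
    using \<open>0 < \<epsilon>\<close> K(1)
    by (intro compact_uniformly_continuous continuous_on_subset[OF cont'] compact_Times) auto
  have bound: "\<exists>d>0. \<forall>t. \<bar>t\<bar> < d \<longrightarrow>
      \<bar>(LINT x:B|lborel. a t x) - (LINT x:B|lborel. a 0 x) - t * (LINT x:B|lborel. a' 0 x)\<bar> \<le> e * \<bar>t\<bar>"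
    if "0 < e" for e
  proof -
    \<comment> \<open>the summand 1 keeps the divisor positive when \<open>B\<close> is a null set\<close>
    define m where "m = measure lborel B + 1"
    have "0 < m" by (simp add: m_def add_nonneg_pos)
    then have "0 < e / m" using \<open>0 < e\<close> by simp
    then obtain d where d: "d > 0" "\<And>p q. p \<in> K \<times> {-\<epsilon>/2..\<epsilon>/2} \<Longrightarrow> q \<in> K \<times> {-\<epsilon>/2..\<epsilon>/2} \<Longrightarrow>
        dist q p < d \<Longrightarrow> dist ((\<lambda>(x, t). a' t x) q) ((\<lambda>(x, t). a' t x) p) < e / m"
      using unif unfolding uniformly_continuous_on_def by meson
    show ?thesis
    proof (intro exI conjI allI impI)
      show "0 < min d (\<epsilon>/2)" using d \<open>0 < \<epsilon>\<close> by simp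
      fix t assume t: "\<bar>t\<bar> < min d (\<epsilon>/2)"
      have le: "\<bar>a t x - a 0 x - t * a' 0 x\<bar> \<le> e / m * \<bar>t\<bar>" if "x \<in> K" for x
      proof -
        have "norm ((a t x - t * a' 0 x) - (a 0 x - 0 * a' 0 x)) \<le> e / m * norm (t - 0)"
        proof (rule field_differentiable_bound)
          let ?I = "{- \<bar>t\<bar>..\<bar>t\<bar>}"
          show "convex ?I" by simp
          fix s assume s: "s \<in> ?I"
          then have "\<bar>s\<bar> < \<epsilon>" using t by auto
          from deriv[OF \<open>x \<in> K\<close> this]
          have "((\<lambda>s. a s x) has_real_derivative a' s x) (at s within ?I)"
            by (rule has_field_derivative_at_within)
          then show "((\<lambda>s. a s x - s * a' 0 x) has_real_derivative (a' s x - a' 0 x)) (at s within ?I)"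
            by (auto intro!: derivative_eq_intros)
          have "dist ((\<lambda>(x, t). a' t x) (x, s)) ((\<lambda>(x, t). a' t x) (x, 0)) < e / m"
            using s t \<open>x \<in> K\<close> by (intro d(2)) (auto simp: dist_Pair_Pair)
          then show "norm (a' s x - a' 0 x) \<le> e / m" by (simp add: dist_norm)
        qed auto
        then show ?thesis by (simp add: algebra_simps)
      qed
      have t\<epsilon>: "\<bar>t\<bar> < \<epsilon>" using t \<open>0 < \<epsilon>\<close> by simp
      have int: "set_integrable lborel B (a t)" "set_integrable lborel B (a 0)"
          "set_integrable lborel B (\<lambda>x. t * a' 0 x)"
          "set_integrable lborel B (\<lambda>x. a t x - a 0 x - t * a' 0 x)"
        using cont[OF t\<epsilon>] cont[of 0] \<open>0 < \<epsilon>\<close> cont0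
        by (auto intro!: integrable continuous_intros)
      have "\<bar>(LINT x:B|lborel. a t x) - (LINT x:B|lborel. a 0 x) - t * (LINT x:B|lborel. a' 0 x)\<bar> =
          \<bar>LINT x:B|lborel. a t x - a 0 x - t * a' 0 x\<bar>"
        using int by simp
      also have "\<dots> \<le> (LINT x:B|lborel. \<bar>a t x - a 0 x - t * a' 0 x\<bar>)"
        using set_integral_norm_bound[OF int(4)] by simp
      also have "\<dots> \<le> (LINT x:B|lborel. e / m * \<bar>t\<bar>)"
      proof (rule set_integral_mono)
        show "set_integrable lborel B (\<lambda>x. \<bar>a t x - a 0 x - t * a' 0 x\<bar>)"
          using set_integrable_norm[OF int(4)] by simp
        show "set_integrable lborel B (\<lambda>x. e / m * \<bar>t\<bar>)" by (intro integrable continuous_intros)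
      qed (use le K in blast)
      also have "\<dots> = measure lborel B * (e / m * \<bar>t\<bar>)"
        using set_integral_const[OF B, of "e / m * \<bar>t\<bar>"] by simp
      also have "\<dots> \<le> m * (e / m * \<bar>t\<bar>)"
        using \<open>0 < e / m\<close> by (intro mult_right_mono mult_nonneg_nonneg) (auto simp: m_def)
      also have "\<dots> = e * \<bar>t\<bar>" using \<open>0 < m\<close> by simp
      finally show "\<bar>(LINT x:B|lborel. a t x) - (LINT x:B|lborel. a 0 x) - t * (LINT x:B|lborel. a' 0 x)\<bar> \<le> e * \<bar>t\<bar>" .
    qed
  qed
  show ?thesis
    unfolding has_field_derivative_def has_derivative_at_alt
    using bound by (auto simp: bounded_linear_mult_right mult.commute)
qed

text \<open>Finitely many charts have compact coordinate discs \<open>C\<^sub>0, C\<^sub>1, \<dots>\<close> that cover the compact set; removing from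
  each disc the preceding ones makes the pieces disjoint. In coordinates a piece is a compact set
  minus finitely many compact sets, hence Borel.\<close>

lemma chart_partition_exists:
  assumes S: "oriented_surface T \<A>" and K: "compactin T S"
  shows "\<exists>n c Q. chart_partition T \<A> S n c Q"
proof -
  have "\<exists>c V C. c \<in> \<A> \<and> p \<in> V \<and> openin T V \<and> V \<subseteq> C \<and> compactin T C \<and> C \<subseteq> fst c" if "p \<in> S" for p
  proof -
    have "p \<in> topspace T" using K that compactin_subset_topspace by blast
    then obtain c where c: "c \<in> \<A>" "p \<in> fst c" using chart_at[OF S] by blast
    note chart = oriented_surface_chart[OF S c(1)]
    obtain r where r: "r > 0" "cball (snd c p) r \<subseteq> snd c ` fst c"
      using chart_image_open[OF chart] c(2) by (meson imageI open_contains_cball)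
    show ?thesis
    proof (intro exI conjI)
      show "p \<in> chart_inv c ` ball (snd c p) r"
        using chart_inv_chart[OF chart c(2)] r(1) by (metis centre_in_ball imageI)
      show "openin T (chart_inv c ` ball (snd c p) r)"
        using r ball_subset_cball by (intro openin_chart_inv_image[OF chart]) (auto intro: order_trans)
      show "chart_inv c ` ball (snd c p) r \<subseteq> chart_inv c ` cball (snd c p) r" by auto
      show "compactin T (chart_inv c ` cball (snd c p) r)"
        using r by (intro compactin_chart_inv_image[OF chart]) auto
      show "chart_inv c ` cball (snd c p) r \<subseteq> fst c"
        using r chart_inv_mem[OF chart] by blast
    qed fact
  qed
  then obtain c V C where cVC: "\<And>p. p \<in> S \<Longrightarrow> c p \<in> \<A> \<and> p \<in> V p \<and> openin T (V p) \<and> V p \<subseteq> C p \<and>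
      compactin T (C p) \<and> C p \<subseteq> fst (c p)"
    by metis
  have "\<exists>\<F>. finite \<F> \<and> \<F> \<subseteq> V ` S \<and> S \<subseteq> \<Union>\<F>"
    using cVC by (intro compactinD[OF K]) blast+
  then obtain F where F: "finite F" "F \<subseteq> S" "S \<subseteq> (\<Union>p\<in>F. V p)"
    by (metis finite_subset_image)
  obtain n and e :: "nat \<Rightarrow> 'a" where e: "F = e ` {i. i < n}"
    using F(1) finite_imp_nat_seg_image_inj_on by blast
  define Q where "Q i = (S \<inter> C (e i)) - (\<Union>j<i. C (e j))" for i
  have eS: "e i \<in> S" if "i < n" for i using that e F(2) by auto
  have closed: "closedin T S" "closedin T (C p)" if "p \<in> S" for p
    using that K cVC S compactin_imp_closedin[of T] by (auto simp: oriented_surface_def)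
  have "chart_partition T \<A> S n (c \<circ> e) Q"
    unfolding chart_partition_def
  proof (intro conjI allI impI)
    fix i assume i: "i < n"
    note props = cVC[OF eS[OF i]]
    show "(c \<circ> e) i \<in> \<A>" using props by simp
    then have chart: "is_chart T (c (e i))" by (simp add: oriented_surface_chart[OF S])
    show "\<exists>Ca. compactin T Ca \<and> Q i \<subseteq> Ca \<and> Ca \<subseteq> fst ((c \<circ> e) i)"
      using props by (intro exI[of _ "C (e i)"]) (auto simp: Q_def)
    have image: "compact (snd (c (e i)) ` (C (e i) \<inter> Z))" if "closedin T Z" for Z
      using props that by (intro compact_chart_image[OF chart] compact_Int_closedin) auto
    have "Q i = C (e i) \<inter> S - (\<Union>j<i. C (e i) \<inter> C (e j))" by (auto simp: Q_def)
    moreover have "inj_on (snd (c (e i))) (C (e i))"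
      using chart_inj[OF chart] props inj_on_subset by blast
    ultimately have "snd (c (e i)) ` Q i =
        snd (c (e i)) ` (C (e i) \<inter> S) - (\<Union>j<i. snd (c (e i)) ` (C (e i) \<inter> C (e j)))"
      by (simp only: image_UN[symmetric]) (auto simp: inj_on_def)
    moreover have "closed (snd (c (e i)) ` (C (e i) \<inter> S))"
      using closed(1)[OF eS[OF i]] image compact_imp_closed by blast
    moreover have "closed (snd (c (e i)) ` (C (e i) \<inter> C (e j)))" if "j < i" for j
      using that i eS[of j] closed(2)[of "e j"] image compact_imp_closed by auto
    ultimately show "snd ((c \<circ> e) i) ` Q i \<in> sets borel"
      by (auto intro!: sets.Diff sets.finite_UN borel_closed)
  next
    show "disjoint_family_on Q {..<n}"
    proof (unfold disjoint_family_on_def, intro ballI impI)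
      fix i j :: nat assume "i \<noteq> j"
      then show "Q i \<inter> Q j = {}" by (cases i j rule: linorder_cases) (auto simp: Q_def)
    qed
    show "(\<Union>i<n. Q i) = S"
    proof
      show "S \<subseteq> (\<Union>i<n. Q i)"
      proof
        fix p assume p: "p \<in> S"
        then have ex: "\<exists>i. i < n \<and> p \<in> C (e i)"
          using F(3) cVC eS unfolding e by blast
        define i where "i = (LEAST i. i < n \<and> p \<in> C (e i))"
        have i: "i < n" "p \<in> C (e i)" using LeastI_ex[OF ex] by (auto simp: i_def)
        moreover have "p \<notin> C (e j)" if "j < i" for j
          using that i(1) not_less_Least[of j "\<lambda>i. i < n \<and> p \<in> C (e i)"] by (auto simp: i_def)
        ultimately show "p \<in> (\<Union>i<n. Q i)" using p by (auto simp: Q_def)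
      qed
    qed (auto simp: Q_def)
  qed
  then show ?thesis by blast
qed

text \<open>The partition chosen in the definition of the integral depends on the set only, so that one and the
  same partition serves all 2-forms, in particular all area elements of a variation.\<close>

lemma form_integral_as_sum:
  assumes "oriented_surface T \<A>" "compactin T S"
  obtains n c Q where "chart_partition T \<A> S n c Q"
    and "\<And>w. form_integral T \<A> S w =
      (\<Sum>i<n. set_lebesgue_integral lborel (snd (c i) ` Q i) (\<lambda>x. w (c i) (chart_inv (c i) x)))"
proof -
  define P where "P = (SOME (n, c, Q). chart_partition T \<A> S n c Q)"
  have "\<exists>P. case P of (n, c, Q) \<Rightarrow> chart_partition T \<A> S n c Q"
    using chart_partition_exists[OF assms] by auto
  from someI_ex[OF this] have "case P of (n, c, Q) \<Rightarrow> chart_partition T \<A> S n c Q"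
    by (simp add: P_def)
  moreover obtain n c Q where "P = (n, c, Q)" by (cases P)
  ultimately show ?thesis
    using that[of n c Q] by (simp add: form_integral_def P_def)
qed

lemma chart_partition_piece:
  assumes S: "oriented_surface T \<A>" and K: "compactin T S"
    and part: "chart_partition T \<A> S n c Q" and i: "i < n"
  obtains K where "c i \<in> \<A>" "compact K" "snd (c i) ` Q i \<subseteq> K" "K \<subseteq> snd (c i) ` (fst (c i) \<inter> S)"
    "snd (c i) ` Q i \<in> sets borel"
proof -
  obtain C where C: "c i \<in> \<A>" "compactin T C" "Q i \<subseteq> C" "C \<subseteq> fst (c i)" "snd (c i) ` Q i \<in> sets borel"
    using part i unfolding chart_partition_def by blast
  have "Q i \<subseteq> S" using part i by (auto simp: chart_partition_def)
  moreover have "closedin T S" using S K by (auto simp: oriented_surface_def intro: compactin_imp_closedin)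
  ultimately show ?thesis
    using C by (intro that[of "snd (c i) ` (C \<inter> S)"] compact_chart_image[OF oriented_surface_chart[OF S]]
       compact_Int_closedin) auto
qed

lemma form_integral_has_real_derivative:
  assumes S: "oriented_surface T \<A>" and K: "compactin T S" and "0 < \<epsilon>"
    and deriv: "\<And>c p t. c \<in> \<A> \<Longrightarrow> p \<in> fst c \<inter> S \<Longrightarrow> \<bar>t\<bar> < \<epsilon> \<Longrightarrow>
      ((\<lambda>t. w t c p) has_real_derivative w' t c p) (at t)"
    and cont: "\<And>c t. c \<in> \<A> \<Longrightarrow> \<bar>t\<bar> < \<epsilon> \<Longrightarrow>
      continuous_on (snd c ` (fst c \<inter> S)) (\<lambda>x. w t c (chart_inv c x))"
    and cont': "\<And>c. c \<in> \<A> \<Longrightarrow>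
      continuous_on (snd c ` (fst c \<inter> S) \<times> {-\<epsilon><..<\<epsilon>}) (\<lambda>(x, t). w' t c (chart_inv c x))"
  shows "((\<lambda>t. form_integral T \<A> S (w t)) has_real_derivative form_integral T \<A> S (w' 0)) (at 0)"
proof -
  obtain n c Q where part: "chart_partition T \<A> S n c Q"
    and eq: "\<And>w. form_integral T \<A> S w =
      (\<Sum>i<n. set_lebesgue_integral lborel (snd (c i) ` Q i) (\<lambda>x. w (c i) (chart_inv (c i) x)))"
    using form_integral_as_sum[OF S K] by blast
  show ?thesis
    unfolding eq
  proof (rule DERIV_sum)
    fix i assume "i \<in> {..<n}"
    then obtain K where K: "c i \<in> \<A>" "compact K" "snd (c i) ` Q i \<subseteq> K"
        "K \<subseteq> snd (c i) ` (fst (c i) \<inter> S)" "snd (c i) ` Q i \<in> sets borel"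
      using chart_partition_piece[OF S K part] by (metis lessThan_iff)
    show "((\<lambda>t. set_lebesgue_integral lborel (snd (c i) ` Q i) (\<lambda>x. w t (c i) (chart_inv (c i) x)))
        has_real_derivative
          set_lebesgue_integral lborel (snd (c i) ` Q i) (\<lambda>x. w' 0 (c i) (chart_inv (c i) x))) (at 0)"
    proof (rule has_real_derivative_set_lebesgue_integral[OF K(2,5,3) \<open>0 < \<epsilon>\<close>])
      fix x t assume "x \<in> K" "\<bar>t\<bar> < \<epsilon>"
      moreover have "chart_inv (c i) x \<in> fst (c i) \<inter> S"
        using \<open>x \<in> K\<close> K(4) by (intro chart_inv_in_Int[OF oriented_surface_chart[OF S K(1)]]) auto
      ultimately show "((\<lambda>t. w t (c i) (chart_inv (c i) x)) has_real_derivative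
          w' t (c i) (chart_inv (c i) x)) (at t)"
        using deriv K(1) by blast
    qed (use K in \<open>auto intro: continuous_on_subset[OF cont] continuous_on_subset[OF cont']\<close>)
  qed
qed

lemma form_integral_cong:
  assumes S: "oriented_surface T \<A>" and K: "compactin T S"
    and eq: "\<And>c p. c \<in> \<A> \<Longrightarrow> p \<in> fst c \<inter> S \<Longrightarrow> w c p = w' c p"
  shows "form_integral T \<A> S w = form_integral T \<A> S w'"
proof -
  obtain n c Q where part: "chart_partition T \<A> S n c Q"
    and sum: "\<And>w. form_integral T \<A> S w =
      (\<Sum>i<n. set_lebesgue_integral lborel (snd (c i) ` Q i) (\<lambda>x. w (c i) (chart_inv (c i) x)))"
    using form_integral_as_sum[OF S K] by blast
  show ?thesis
    unfolding sum
  proof (rule sum.cong[OF refl])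
    fix i assume "i \<in> {..<n}"
    then obtain K where K: "c i \<in> \<A>" "snd (c i) ` Q i \<subseteq> K"
        "K \<subseteq> snd (c i) ` (fst (c i) \<inter> S)" "snd (c i) ` Q i \<in> sets borel"
      using chart_partition_piece[OF S K part] by (metis lessThan_iff)
    have "w (c i) (chart_inv (c i) x) = w' (c i) (chart_inv (c i) x)" if "x \<in> snd (c i) ` Q i" for x
      using that K(1-3) by (intro eq chart_inv_in_Int[OF oriented_surface_chart[OF S K(1)]]) auto
    then show "set_lebesgue_integral lborel (snd (c i) ` Q i) (\<lambda>x. w (c i) (chart_inv (c i) x)) =
       set_lebesgue_integral lborel (snd (c i) ` Q i) (\<lambda>x. w' (c i) (chart_inv (c i) x))"
      using K by (intro set_lebesgue_integral_cong) auto
  qed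
qed

text \<open>A piece of the partition contributes a positive amount unless it is a null set in its chart. Not all
  pieces are null: chart transitions are differentiable and map null sets to null sets, so the
  pieces would otherwise cover a nonempty open subset of a chart by finitely many null sets.\<close>

lemma form_integral_pos:
  assumes S: "oriented_surface T \<A>" and K: "compactin T S"
    and D: "openin T D" "D \<noteq> {}" "D \<subseteq> S"
    and pos: "\<And>c p. c \<in> \<A> \<Longrightarrow> p \<in> fst c \<inter> S \<Longrightarrow> 0 < w c p"
    and cont: "\<And>c. c \<in> \<A> \<Longrightarrow> continuous_on (snd c ` (fst c \<inter> S)) (\<lambda>x. w c (chart_inv c x))"
  shows "0 < form_integral T \<A> S w"
proof (rule ccontr)
  obtain n c Q where part: "chart_partition T \<A> S n c Q"
    and sum: "\<And>w. form_integral T \<A> S w =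
      (\<Sum>i<n. set_lebesgue_integral lborel (snd (c i) ` Q i) (\<lambda>x. w (c i) (chart_inv (c i) x)))"
    using form_integral_as_sum[OF S K] by blast
  let ?B = "\<lambda>i. snd (c i) ` Q i"
  let ?I = "\<lambda>i. set_lebesgue_integral lborel (?B i) (\<lambda>x. w (c i) (chart_inv (c i) x))"
  assume "\<not> 0 < form_integral T \<A> S w"
  have nonneg: "0 \<le> ?I i \<and> (?I i = 0 \<longrightarrow> negligible (?B i)) \<and> c i \<in> \<A> \<and> Q i \<subseteq> fst (c i)"
    if i: "i < n" for i
  proof -
    obtain L where L: "c i \<in> \<A>" "compact L" "?B i \<subseteq> L"
        "L \<subseteq> snd (c i) ` (fst (c i) \<inter> S)" "?B i \<in> sets borel"
      using chart_partition_piece[OF S K part i] .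
    have Q: "Q i \<subseteq> fst (c i)" using part i by (auto simp: chart_partition_def)
    have wpos: "0 < w (c i) (chart_inv (c i) x)" if "x \<in> ?B i" for x
      using that L(1,3,4) by (intro pos chart_inv_in_Int[OF oriented_surface_chart[OF S L(1)]]) auto
    have int: "integrable lborel (\<lambda>x. indicator (?B i) x * w (c i) (chart_inv (c i) x))"
      using set_integrable_subset_compact[OF L(2,5,3) continuous_on_subset[OF cont[OF L(1)] L(4)]]
      by (simp add: set_integrable_def)
    have nn: "0 \<le> indicator (?B i) x * w (c i) (chart_inv (c i) x)" for x
      using wpos[of x] by (cases "x \<in> ?B i") (simp_all add: less_imp_le)
    have "?I i \<ge> 0"
      unfolding set_lebesgue_integral_def using nn by (intro integral_nonneg_AE) auto
    moreover have "negligible (?B i)" if "?I i = 0"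
    proof -
      have "AE x in lborel. indicator (?B i) x * w (c i) (chart_inv (c i) x) = 0"
        using that integral_nonneg_eq_0_iff_AE[OF int] nn by (simp add: set_lebesgue_integral_def)
      moreover have "x \<notin> ?B i" if "indicator (?B i) x * w (c i) (chart_inv (c i) x) = 0" for x
        using that wpos[of x] by (cases "x \<in> ?B i") auto
      ultimately have "AE x in lborel. x \<notin> ?B i"
        by (rule eventually_mono)
      then have "?B i \<in> null_sets lborel"
        using L(5) AE_iff_null_sets[of "?B i" lborel] by simp
      then show ?thesis
        by (simp add: negligible_iff_null_sets null_sets_completionI)
    qed
    ultimately show ?thesis using L(1) Q by blast
  qed
  have "(\<Sum>i<n. ?I i) \<le> 0" using \<open>\<not> 0 < form_integral T \<A> S w\<close> unfolding sum by simp
  moreover have nonneg': "\<forall>i\<in>{..<n}. 0 \<le> ?I i" using nonneg by blast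
  ultimately have "(\<Sum>i<n. ?I i) = 0" by (intro order.antisym sum_nonneg) auto
  then have "\<forall>i\<in>{..<n}. ?I i = 0" using nonneg' by (subst (asm) sum_nonneg_eq_0_iff) auto
  then have zero: "?I i = 0" if "i < n" for i using that by blast
  obtain p where p: "p \<in> D" using D by blast
  then obtain d where d: "d \<in> \<A>" "p \<in> fst d"
    using chart_at[OF S] openin_subset[OF D(1)] by blast
  let ?U = "snd d ` (fst d \<inter> D)"
  have "?U \<subseteq> (\<Union>i<n. (snd d \<circ> chart_inv (c i)) ` snd (c i) ` (fst d \<inter> Q i))"
  proof
    fix x assume "x \<in> ?U"
    then obtain q where q: "q \<in> fst d" "q \<in> D" "x = snd d q" by blast
    then obtain i where i: "i < n" "q \<in> Q i"
      using D(3) part unfolding chart_partition_def by blast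
    have "c i \<in> \<A>" "q \<in> fst (c i)" using nonneg[OF i(1)] i(2) by auto
    then have "x = (snd d \<circ> chart_inv (c i)) (snd (c i) q)"
      using q(3) chart_inv_chart[OF oriented_surface_chart[OF S]] by (metis comp_apply)
    then show "x \<in> (\<Union>i<n. (snd d \<circ> chart_inv (c i)) ` snd (c i) ` (fst d \<inter> Q i))"
      using i q by blast
  qed
  moreover have "negligible (\<Union>i<n. (snd d \<circ> chart_inv (c i)) ` snd (c i) ` (fst d \<inter> Q i))"
  proof (intro negligible_Union)
    show "negligible X" if X': "X \<in> (\<lambda>i. (snd d \<circ> chart_inv (c i)) ` snd (c i) ` (fst d \<inter> Q i)) ` {..<n}" for X
    proof -
      obtain i where "i \<in> {..<n}" and X: "X = (snd d \<circ> chart_inv (c i)) ` snd (c i) ` (fst d \<inter> Q i)"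
        using X' by (rule imageE)
      then have i: "i < n" by simp
      show ?thesis
        unfolding X
      proof (rule negligible_differentiable_image_negligible)
        show "negligible (snd (c i) ` (fst d \<inter> Q i))"
        proof (rule negligible_subset)
          show "negligible (?B i)"
            using nonneg[OF i, THEN conjunct2, THEN conjunct1] zero[OF i] by (rule mp)
        qed blast
        show "(snd d \<circ> chart_inv (c i)) differentiable_on snd (c i) ` (fst d \<inter> Q i)"
          unfolding differentiable_on_def
        proof
          fix x assume "x \<in> snd (c i) ` (fst d \<inter> Q i)"
          then obtain q where "q \<in> fst d" "q \<in> Q i" "x = snd (c i) q" by blast
          moreover then have "c i \<in> \<A>" "q \<in> fst (c i)" using nonneg[OF i] by auto
          ultimately have "(snd d \<circ> chart_inv (c i)) differentiable at x"
            using transition_deriv(1)[OF S _ d(1)] unfolding differentiable_def by blast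
          then show "(snd d \<circ> chart_inv (c i)) differentiable at x within snd (c i) ` (fst d \<inter> Q i)"
            by (rule differentiable_at_withinI)
        qed
      qed simp
    qed
  qed simp
  ultimately have "negligible ?U" using negligible_subset by blast
  moreover have "open ?U" using open_chart_image[OF oriented_surface_chart[OF S d(1)] D(1)] .
  ultimately show False using open_not_negligible[of ?U] p d(2) by blast
qed

section \<open>Smooth maps on a surface\<close>

lemma smooth_map_onE:
  assumes "smooth_map_on T \<A> X h"
  obtains W where "openin T W" "X \<subseteq> W"
    "\<And>c. c \<in> \<A> \<Longrightarrow> smooth_on (snd c ` (fst c \<inter> W)) (h \<circ> chart_inv c)"
  using assms unfolding smooth_map_on_def by blast

lemma smooth_map_on_differentiable:
  fixes h :: "'m \<Rightarrow> 'b::euclidean_space"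
  assumes "smooth_map_on T \<A> X h" "c \<in> \<A>" "p \<in> fst c" "p \<in> X"
  shows "(h \<circ> chart_inv c has_derivative chart_deriv c h p) (at (snd c p))"
    and "(h \<circ> chart_inv c) differentiable (at (snd c p))" and "linear (chart_deriv c h p)"
proof -
  obtain W where "X \<subseteq> W" "smooth_on (snd c ` (fst c \<inter> W)) (h \<circ> chart_inv c)"
    using assms smooth_map_onE by metis
  then show *: "(h \<circ> chart_inv c has_derivative chart_deriv c h p) (at (snd c p))"
    unfolding chart_deriv_def using assms by (intro smooth_on_has_derivative) auto
  then show "(h \<circ> chart_inv c) differentiable (at (snd c p))" "linear (chart_deriv c h p)"
    by (auto simp: differentiable_def dest: has_derivative_linear)
qed

lemma smooth_map_on_continuous:
  fixes h :: "'m \<Rightarrow> 'b::euclidean_space"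
  assumes S: "oriented_surface T \<A>" and h: "smooth_map_on T \<A> X h" and c: "c \<in> \<A>"
  shows "continuous_on (snd c ` (fst c \<inter> X)) (\<lambda>x. h (chart_inv c x))"
    and "continuous_on (snd c ` (fst c \<inter> X)) (\<lambda>x. chart_deriv c h (chart_inv c x) v)"
proof -
  obtain W where W: "X \<subseteq> W" "smooth_on (snd c ` (fst c \<inter> W)) (h \<circ> chart_inv c)"
    using h c smooth_map_onE by metis
  then have sub: "snd c ` (fst c \<inter> X) \<subseteq> snd c ` (fst c \<inter> W)" by auto
  show "continuous_on (snd c ` (fst c \<inter> X)) (\<lambda>x. h (chart_inv c x))"
    using continuous_on_subset[OF smooth_on_imp_continuous_on[OF W(2)] sub] by (simp add: comp_def)
  have "continuous_on (snd c ` (fst c \<inter> X)) (\<lambda>x. frechet_derivative (h \<circ> chart_inv c) (at x) v)"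
    using continuous_on_subset[OF smooth_on_continuous_derivative[OF W(2)] sub] .
  then show "continuous_on (snd c ` (fst c \<inter> X)) (\<lambda>x. chart_deriv c h (chart_inv c x) v)"
  proof (rule continuous_on_eq)
    fix x assume "x \<in> snd c ` (fst c \<inter> X)"
    then have "x \<in> snd c ` fst c" by auto
    then show "frechet_derivative (h \<circ> chart_inv c) (at x) v = chart_deriv c h (chart_inv c x) v"
      by (simp add: chart_deriv_def chart_chart_inv[OF oriented_surface_chart[OF S c]])
  qed
qed

lemma smooth_map_on_subset: "smooth_map_on T \<A> Y h \<Longrightarrow> X \<subseteq> Y \<Longrightarrow> smooth_map_on T \<A> X h"
  unfolding smooth_map_on_def by blast

lemma smooth_map_on_topspace_smooth_on:
  assumes S: "oriented_surface T \<A>" and h: "smooth_map_on T \<A> (topspace T) h" and c: "c \<in> \<A>"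
  shows "smooth_on (snd c ` fst c) (h \<circ> chart_inv c)"
proof -
  obtain W where "topspace T \<subseteq> W" "smooth_on (snd c ` (fst c \<inter> W)) (h \<circ> chart_inv c)"
    using h c smooth_map_onE by metis
  moreover then have "fst c \<inter> W = fst c"
    using chart_domain[OF oriented_surface_chart[OF S c]] by auto
  ultimately show ?thesis by simp
qed

lemma transition_deriv_inj:
  assumes "oriented_surface T \<A>" "c \<in> \<A>" "d \<in> \<A>" "p \<in> fst c" "p \<in> fst d"
  shows "linear (transition_deriv c d p)" "inj (transition_deriv c d p)"
proof -
  show "linear (transition_deriv c d p)"
    using transition_deriv(1)[OF assms] has_derivative_linear by blast
  then show "inj (transition_deriv c d p)"
    using transition_deriv(2)[OF assms] det_nz_iff_inj by force
qed

lemma area_form_eq_cross3: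
  "area_form h e c p =
     cross3 (chart_deriv c h p (axis 1 1)) (chart_deriv c h p (axis 2 1)) \<bullet> e p"
  unfolding area_form_def by (simp add: cross3_simps)

text \<open>The area element is a 2-form. As the Jacobian determinants of the atlas are positive, its sign at a
  point is the same in all charts.\<close>

lemma area_form_transition:
  assumes S: "oriented_surface T \<A>" and cd: "c \<in> \<A>" "d \<in> \<A>" "p \<in> fst c" "p \<in> fst d"
    and h: "smooth_map_on T \<A> X h" "p \<in> X"
  shows "area_form h e c p = det (matrix (transition_deriv c d p)) * area_form h e d p"
proof -
  let ?J = "transition_deriv c d p" and ?B = "chart_deriv d h p"
  note diff = smooth_map_on_differentiable[OF h(1) cd(2,4) h(2)]
  have "chart_deriv c h p = ?B \<circ> ?J" by (rule chart_deriv_transition(2)[OF S cd diff(2)])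
  then have "area_form h e c p = cross3 (?B (?J (axis 1 1))) (?B (?J (axis 2 1))) \<bullet> e p"
    by (simp add: area_form_eq_cross3)
  also have "\<dots> = det (matrix ?J) * area_form h e d p"
    by (simp add: cross3_linear_images[OF diff(3), of "?J (axis 1 1)"] area_form_eq_cross3
        det_2 matrix_def)
  finally show ?thesis .
qed

lemma birkhoff_orthogonal_mono:
  "birkhoff_orthogonal \<nu> v P \<Longrightarrow> Q \<subseteq> P \<Longrightarrow> birkhoff_orthogonal \<nu> v Q"
  unfolding birkhoff_orthogonal_def by blast

section \<open>Coordinate discs as domains\<close>

text \<open>Compactness of the closed disc makes its image closed in the Hausdorff space, so closure and
  frontier can be read off in the chart.\<close>

lemma coordinate_disc_domain:
  assumes S: "oriented_surface T \<A>" and c: "c \<in> \<A>" and r: "0 < r" "cball x r \<subseteq> snd c ` fst c"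
  defines "D \<equiv> chart_inv c ` ball x r"
  shows "T closure_of D = chart_inv c ` cball x r" and "surface_domain T D"
proof -
  note chart = oriented_surface_chart[OF S c]
  let ?U = "snd c ` fst c"
  have b: "ball x r \<subseteq> ?U" using r by auto
  note hom = chart_inv_homeomorphic_map[OF chart]
  have D: "openin T D" unfolding D_def by (rule openin_chart_inv_image[OF chart open_ball b])
  have C: "compactin T (chart_inv c ` cball x r)"
    by (rule compactin_chart_inv_image[OF chart compact_cball r(2)])
  have Dc: "D \<subseteq> chart_inv c ` cball x r" unfolding D_def by auto
  have "closedin T (chart_inv c ` cball x r)"
    using S C compactin_imp_closedin by (auto simp: oriented_surface_def)
  then have 1: "T closure_of D \<subseteq> chart_inv c ` cball x r" by (rule closure_of_minimal[OF Dc])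
  have "chart_inv c ` (top_of_set ?U closure_of ball x r) \<subseteq> T closure_of D"
    unfolding D_def using continuous_map_image_closure_subset[OF chart_inv_continuous_map[OF chart]] .
  moreover have "top_of_set ?U closure_of ball x r = cball x r"
    using b r by (simp add: closure_of_subtopology inf.absorb2)
  ultimately show cl: "T closure_of D = chart_inv c ` cball x r" using 1 by simp
  have fr: "T frontier_of D = chart_inv c ` sphere x r"
  proof -
    have "inj_on (chart_inv c) ?U" by (rule inj_on_inverseI[of _ "snd c"]) (rule chart_chart_inv[OF chart])
    then have "inj_on (chart_inv c) (cball x r)" using r(2) inj_on_subset by blast
    then have "chart_inv c ` cball x r - D = chart_inv c ` (cball x r - ball x r)"
      unfolding D_def using ball_subset_cball by (metis inj_on_image_set_diff Diff_subset order_refl)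
    then show ?thesis by (simp add: frontier_of_def cl interior_of_openin[OF D] cball_diff_eq_sphere)
  qed
  have conn: "connectedin T D"
    unfolding D_def using connectedin_continuous_map_image[OF chart_inv_continuous_map[OF chart]] b
    by (simp add: connectedin_subtopology)
  have "sphere x r homeomorphic sphere (0::real^2) 1"
    using r by (intro homeomorphic_spheres_gen) auto
  then obtain h k where hk: "homeomorphism (sphere x r) (sphere (0::real^2) 1) h k"
    unfolding homeomorphic_def by blast
  then have "homeomorphic_maps (top_of_set (sphere x r)) (top_of_set (sphere (0::real^2) 1)) h k"
    by (auto simp: homeomorphic_maps_def homeomorphism_def)
  then have sph: "top_of_set (sphere x r) homeomorphic_space top_of_set (sphere (0::real^2) 1)"
    unfolding homeomorphic_space_def by blast
  have sU: "sphere x r \<subseteq> ?U" using r(2) sphere_cball by blast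
  have "homeomorphic_map (subtopology (top_of_set ?U) (sphere x r))
      (subtopology (subtopology T (fst c)) (chart_inv c ` sphere x r)) (chart_inv c)"
    using sU chart_inv_mem[OF chart] chart_domain[OF chart]
    by (intro homeomorphic_map_subtopologies[OF hom]) (auto simp: Int_absorb1)
  moreover have "chart_inv c ` sphere x r \<subseteq> fst c" using sU chart_inv_mem[OF chart] by blast
  ultimately have "top_of_set (sphere x r) homeomorphic_space subtopology T (chart_inv c ` sphere x r)"
    using sU by (simp add: subtopology_subtopology Int_absorb1 homeomorphic_map_imp_homeomorphic_space)
  then have "subtopology T (T frontier_of D) homeomorphic_space top_of_set (sphere (0::real^2) 1)"
    unfolding fr using sph homeomorphic_space_sym homeomorphic_space_trans by blast
  then show "surface_domain T D"
    using D conn C by (simp add: surface_domain_def cl)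
qed

section \<open>The Birkhoff-Gauss map and the mean curvature\<close>

context
  fixes \<nu> :: "real^3 \<Rightarrow> real"
    and T :: "'m topology" and \<A> :: "'m chart set"
    and f \<eta> :: "'m \<Rightarrow> real^3"
  assumes norm: "is_norm \<nu>"
    and S: "oriented_surface T \<A>"
    and imm: "immersion_on T \<A> (topspace T) f"
    and gauss: "birkhoff_gauss_map \<nu> T \<A> (topspace T) f \<eta>"
begin

lemma smooth_f: "smooth_map_on T \<A> (topspace T) f"
  using imm by (simp add: immersion_on_def)

lemma smooth_\<eta>: "smooth_map_on T \<A> (topspace T) \<eta>"
  using gauss by (simp add: birkhoff_gauss_map_def)

lemma chart_topspace: "c \<in> \<A> \<Longrightarrow> p \<in> fst c \<Longrightarrow> p \<in> topspace T"
  using chart_domain(2)[OF oriented_surface_chart[OF S]] by blast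

lemma birkhoff_normal_in_chart:
  assumes c: "c \<in> \<A>" "p \<in> fst c"
  shows "inj (chart_deriv c f p)" "birkhoff_orthogonal \<nu> (\<eta> p) (range (chart_deriv c f p))"
proof -
  note p = chart_topspace[OF c]
  let ?d = "chart_at \<A> p"
  note d = chart_at[OF S p]
  have eq: "chart_deriv c f p = chart_deriv ?d f p \<circ> transition_deriv c ?d p"
    using chart_deriv_transition(2)[OF S c(1) d(1) c(2) d(2)]
      smooth_map_on_differentiable(2)[OF smooth_f d p] by blast
  have "inj (chart_deriv ?d f p)" using imm p by (simp add: immersion_on_def)
  then show "inj (chart_deriv c f p)"
    unfolding eq using transition_deriv_inj(2)[OF S c(1) d(1) c(2) d(2)] by (rule inj_compose)
  have "birkhoff_orthogonal \<nu> (\<eta> p) (tangent_plane \<A> f p)"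
    using gauss p by (simp add: birkhoff_gauss_map_def)
  then show "birkhoff_orthogonal \<nu> (\<eta> p) (range (chart_deriv c f p))"
    by (rule birkhoff_orthogonal_mono) (auto simp: tangent_plane_def eq)
qed

lemma \<nu>_\<eta>: "p \<in> topspace T \<Longrightarrow> \<nu> (\<eta> p) = 1"
  using gauss by (simp add: birkhoff_gauss_map_def)

lemma area_form_nonzero:
  assumes c: "c \<in> \<A>" "p \<in> fst c"
  shows "area_form f \<eta> c p \<noteq> 0"
proof -
  note p = chart_topspace[OF c]
  show ?thesis
    unfolding area_form_eq_cross3
    using birkhoff_orthogonal_normal_bound(1)[OF norm _ birkhoff_normal_in_chart[OF c] \<nu>_\<eta>[OF p]]
      smooth_map_on_differentiable(3)[OF smooth_f c p] by blast
qed

lemma gauss_map_deriv_tangent: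
  assumes c: "c \<in> \<A>" "p \<in> fst c"
  shows "chart_deriv c \<eta> p v \<in> range (chart_deriv c f p)"
proof -
  note p = chart_topspace[OF c] and chart = oriented_surface_chart[OF S c(1)]
  have inv: "chart_inv c (snd c p) = p" by (rule chart_inv_chart[OF chart c(2)])
  show ?thesis
  proof (rule normal_derivative_tangent[OF norm, where e = "\<eta> \<circ> chart_inv c" and x = "snd c p"])
    show "linear (chart_deriv c f p)" by (rule smooth_map_on_differentiable(3)[OF smooth_f c p])
    show "(\<eta> \<circ> chart_inv c has_derivative chart_deriv c \<eta> p) (at (snd c p))"
      by (rule smooth_map_on_differentiable(1)[OF smooth_\<eta> c p])
    show "open (snd c ` fst c)" by (rule chart_image_open[OF chart])
    show "snd c p \<in> snd c ` fst c" using c by blast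
    show "\<nu> ((\<eta> \<circ> chart_inv c) x) = 1" if "x \<in> snd c ` fst c" for x
      using that chart_inv_mem[OF chart] chart_topspace[OF c(1)] \<nu>_\<eta> by simp
  qed (use birkhoff_normal_in_chart[OF c] inv in simp_all)
qed

text \<open>The shape operator really exists: \<open>d\<eta>\<close> takes values in the tangent plane, which \<open>df\<close>
  parametrizes injectively. So the definite description in its definition denotes it.\<close>

lemma gauss_map_matrix:
  assumes p: "p \<in> topspace T"
  defines "c \<equiv> chart_at \<A> p"
  shows "chart_deriv c \<eta> p v = chart_deriv c f p (gauss_map_matrix \<A> f \<eta> p *v v)"
proof -
  note c = chart_at[OF S p, folded c_def]
  let ?B = "chart_deriv c f p" and ?N = "chart_deriv c \<eta> p"
  note B = smooth_map_on_differentiable(3)[OF smooth_f c p]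
  note N = smooth_map_on_differentiable(3)[OF smooth_\<eta> c p]
  note inj = birkhoff_normal_in_chart(1)[OF c]
  obtain a where a: "?N (axis 1 1) = ?B a" using gauss_map_deriv_tangent[OF c] by blast
  obtain b where b: "?N (axis 2 1) = ?B b" using gauss_map_deriv_tangent[OF c] by blast
  define A :: "real^2^2" where "A = (\<chi> i j. if j = 1 then a $ i else b $ i)"
  have A: "?N v = ?B (A *v v)" for v
  proof -
    have "A *v v = v $ 1 *\<^sub>R a + v $ 2 *\<^sub>R b"
      by (simp add: A_def vec_eq_iff matrix_vector_mult_def sum_2 mult.commute)
    then show ?thesis
      by (simp add: linear_plane_expand[OF N, of v] a b linear_add[OF B] linear_scale[OF B])
  qed
  have "gauss_map_matrix \<A> f \<eta> p = A"
    unfolding gauss_map_matrix_def Let_def normal_diff_matrix_def c_def[symmetric]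
      chart_deriv_def[symmetric]
  proof (rule the_equality)
    fix A' assume "\<forall>v. ?N v = ?B (A' *v v)"
    then show "A' = A" using A inj by (metis injD matrix_eq)
  qed (use A in blast)
  then show ?thesis using A by simp
qed

text \<open>The mean curvature is defined in one selected chart. Both sides are alternating bilinear in the two
  tangent vectors, which lets the identity be transported to every chart.\<close>

lemma mean_curvature_identity:
  assumes c: "c \<in> \<A>" "p \<in> fst c"
  defines "B \<equiv> chart_deriv c f p" and "N \<equiv> chart_deriv c \<eta> p"
  shows "cross3 (N (axis 1 1)) (B (axis 2 1)) + cross3 (B (axis 1 1)) (N (axis 2 1)) =
    (2 * minkowski_mean_curvature \<A> f \<eta> p) *\<^sub>R cross3 (B (axis 1 1)) (B (axis 2 1))"
proof -
  note p = chart_topspace[OF c]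
  let ?d = "chart_at \<A> p"
  note d = chart_at[OF S p]
  let ?J = "transition_deriv c ?d p" and ?A = "gauss_map_matrix \<A> f \<eta> p"
  let ?B = "chart_deriv ?d f p" and ?N = "chart_deriv ?d \<eta> p"
  have BN: "B = ?B \<circ> ?J" "N = ?N \<circ> ?J"
    unfolding B_def N_def
    using chart_deriv_transition(2)[OF S c(1) d(1) c(2) d(2)] smooth_map_on_differentiable(2)[OF _ d p]
      smooth_f smooth_\<eta> by blast+
  show ?thesis
    using cross3_trace[OF smooth_map_on_differentiable(3)[OF smooth_f d p],
        of ?A "?J (axis 1 1)" "?J (axis 2 1)"]
    by (simp add: BN gauss_map_matrix[OF p] minkowski_mean_curvature_def)
qed

lemma mean_curvature_area_form:
  assumes c: "c \<in> \<A>" "p \<in> fst c"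
  shows "(cross3 (chart_deriv c \<eta> p (axis 1 1)) (chart_deriv c f p (axis 2 1)) +
      cross3 (chart_deriv c f p (axis 1 1)) (chart_deriv c \<eta> p (axis 2 1))) \<bullet> \<eta> p =
    2 * minkowski_mean_curvature \<A> f \<eta> p * area_form f \<eta> c p"
  using mean_curvature_identity[OF c] by (simp add: area_form_eq_cross3)

section \<open>The first variation of area\<close>

lemma variation_map_deriv:
  assumes c: "c \<in> \<A>" "p \<in> fst c" and g: "smooth_map_on T \<A> X g" "p \<in> X"
  shows "chart_deriv c (variation_map f \<eta> g t) p = (\<lambda>v. chart_deriv c f p v +
      t *\<^sub>R (g p *\<^sub>R chart_deriv c \<eta> p v + chart_deriv c g p v *\<^sub>R \<eta> p))"
    and "linear (chart_deriv c (variation_map f \<eta> g t) p)"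
proof -
  note p = chart_topspace[OF c] and chart = oriented_surface_chart[OF S c(1)]
  have inv: "chart_inv c (snd c p) = p" by (rule chart_inv_chart[OF chart c(2)])
  have "((\<lambda>x. (f \<circ> chart_inv c) x + t *\<^sub>R ((g \<circ> chart_inv c) x *\<^sub>R (\<eta> \<circ> chart_inv c) x)) has_derivative
      (\<lambda>v. chart_deriv c f p v + t *\<^sub>R ((g \<circ> chart_inv c) (snd c p) *\<^sub>R chart_deriv c \<eta> p v +
        chart_deriv c g p v *\<^sub>R (\<eta> \<circ> chart_inv c) (snd c p)))) (at (snd c p))"
    by (intro has_derivative_add has_derivative_scaleR_right has_derivative_scaleR
        smooth_map_on_differentiable(1)[OF smooth_f c p]
        smooth_map_on_differentiable(1)[OF smooth_\<eta> c p]
        smooth_map_on_differentiable(1)[OF g(1) c g(2)])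
  moreover have "(\<lambda>x. (f \<circ> chart_inv c) x + t *\<^sub>R ((g \<circ> chart_inv c) x *\<^sub>R (\<eta> \<circ> chart_inv c) x)) =
      variation_map f \<eta> g t \<circ> chart_inv c"
    by (simp add: fun_eq_iff variation_map_def)
  ultimately have D: "(variation_map f \<eta> g t \<circ> chart_inv c has_derivative (\<lambda>v. chart_deriv c f p v +
      t *\<^sub>R (g p *\<^sub>R chart_deriv c \<eta> p v + chart_deriv c g p v *\<^sub>R \<eta> p))) (at (snd c p))"
    by (simp add: inv)
  then show "chart_deriv c (variation_map f \<eta> g t) p = (\<lambda>v. chart_deriv c f p v +
      t *\<^sub>R (g p *\<^sub>R chart_deriv c \<eta> p v + chart_deriv c g p v *\<^sub>R \<eta> p))"
    unfolding chart_deriv_def[of c "variation_map f \<eta> g t"] by (rule frechet_derivative_at[symmetric])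
  then show "linear (chart_deriv c (variation_map f \<eta> g t) p)"
    using has_derivative_linear[OF D] by simp
qed

text \<open>Differentiating the area element \<open>det[\<partial>\<^sub>1F\<^sub>t, \<partial>\<^sub>2F\<^sub>t, \<eta>\<^sub>t]\<close> gives three terms. In the first two,
  the derivative of \<open>g \<eta>\<close> may be replaced by \<open>g d\<eta>\<close>, since the determinant already contains \<open>\<eta>\<close>, and the
  trace identity yields \<open>2 H g \<omega>\<close>. The third term vanishes because the unit vectors \<open>\<eta>\<^sub>t\<close> move
  tangentially at \<open>t = 0\<close>.\<close>

lemma first_variation:
  assumes var: "birkhoff_normal_variation \<nu> T \<A> f \<eta> D g \<epsilon> E"
    and K: "compactin T (T closure_of D)"
  shows "(area_function T \<A> f \<eta> D g E has_real_derivative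
    form_integral T \<A> (T closure_of D)
      (\<lambda>c p. 2 * minkowski_mean_curvature \<A> f \<eta> p * g p * area_form f \<eta> c p)) (at 0)"
proof -
  let ?S = "T closure_of D"
  have "0 < \<epsilon>" and g: "smooth_map_on T \<A> ?S g"
    and E\<nu>: "\<And>t p. t \<in> {-\<epsilon><..<\<epsilon>} \<Longrightarrow> p \<in> ?S \<Longrightarrow> \<nu> (E t p) = 1"
    and E: "smooth_family_on T \<A> ?S \<epsilon> E" and E0: "\<And>p. p \<in> ?S \<Longrightarrow> E 0 p = \<eta> p"
    using var by (auto simp: birkhoff_normal_variation_def birkhoff_gauss_map_def)
  have ST: "?S \<subseteq> topspace T" by (rule closure_of_subset_topspace)
  obtain W where W: "?S \<subseteq> W"
    and EW: "\<And>c. c \<in> \<A> \<Longrightarrow> smooth_on (snd c ` (fst c \<inter> W) \<times> {-\<epsilon><..<\<epsilon>}) (\<lambda>(x, t). E t (chart_inv c x))"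
    using E unfolding smooth_family_on_def by blast
  define G where "G c p v = g p *\<^sub>R chart_deriv c \<eta> p v + chart_deriv c g p v *\<^sub>R \<eta> p" for c p v
  define F where "F t c p v = chart_deriv c f p v + t *\<^sub>R G c p v" for t c p v
  define E' where "E' t c p = frechet_derivative (\<lambda>(x, t). E t (chart_inv c x)) (at (snd c p, t)) (0, 1)"
    for t c p
  let ?w = "\<lambda>t. area_form (variation_map f \<eta> g t) (E t)"
  have w: "?w t c p = cross3 (F t c p (axis 1 1)) (F t c p (axis 2 1)) \<bullet> E t p"
    if "c \<in> \<A>" "p \<in> fst c \<inter> ?S" for t c p
    using variation_map_deriv(1)[OF that(1) _ g, of p t] that
    by (simp add: area_form_eq_cross3 F_def G_def)
  define w' where "w' t c p =
      (cross3 (G c p (axis 1 1)) (F t c p (axis 2 1)) + cross3 (F t c p (axis 1 1)) (G c p (axis 2 1))) \<bullet> E t p +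
      cross3 (F t c p (axis 1 1)) (F t c p (axis 2 1)) \<bullet> E' t c p" for t c p
  have E': "((\<lambda>t. E t p) has_vector_derivative E' t c p) (at t)"
    if "c \<in> \<A>" "p \<in> fst c \<inter> ?S" "\<bar>t\<bar> < \<epsilon>" for t c p
  proof -
    let ?D = "frechet_derivative (\<lambda>(x, t). E t (chart_inv c x)) (at (snd c p, t))"
    have inv: "chart_inv c (snd c p) = p"
      using that chart_inv_chart[OF oriented_surface_chart[OF S that(1)]] by auto
    have D: "((\<lambda>(x, t). E t (chart_inv c x)) has_derivative ?D) (at (snd c p, t))"
      using that W by (intro smooth_on_has_derivative[OF EW[OF that(1)]]) auto
    have "((\<lambda>t. (snd c p, t)) has_derivative (\<lambda>s. (0, s))) (at t)"
      by (intro derivative_eq_intros) auto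
    from has_derivative_compose[OF this D]
    have "((\<lambda>t. E t p) has_derivative (\<lambda>s. ?D (0, s))) (at t)" by (simp add: inv)
    moreover have "?D (0, s) = s *\<^sub>R E' t c p" for s
      using linear_scale[OF has_derivative_linear[OF D], of s "(0, 1)"] by (simp add: E'_def)
    ultimately show ?thesis by (simp add: has_vector_derivative_def)
  qed
  have cross_bilinear: "bounded_bilinear cross3"
    using bilinear_cross by (simp add: bilinear_conv_bounded_bilinear)
  have "((\<lambda>t. form_integral T \<A> ?S (?w t)) has_real_derivative form_integral T \<A> ?S (w' 0)) (at 0)"
  proof (rule form_integral_has_real_derivative[OF S K \<open>0 < \<epsilon>\<close>])
    fix c p t assume c: "c \<in> \<A>" and p: "p \<in> fst c \<inter> ?S" and t: "\<bar>t\<bar> < \<epsilon>"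
    have F': "((\<lambda>t. F t c p v) has_vector_derivative G c p v) (at t)" for v
      unfolding F_def by (auto intro!: derivative_eq_intros)
    have "((\<lambda>t. cross3 (F t c p (axis 1 1)) (F t c p (axis 2 1)) \<bullet> E t p) has_vector_derivative w' t c p) (at t)"
      using bounded_bilinear.has_vector_derivative[OF bounded_bilinear_inner
          bounded_bilinear.has_vector_derivative[OF cross_bilinear F' F'] E'[OF c p t]]
      by (simp add: w'_def add.commute)
    then show "((\<lambda>t. ?w t c p) has_real_derivative w' t c p) (at t)"
      by (simp add: w[OF c p] has_real_derivative_iff_has_vector_derivative)
  next
    fix c assume c: "c \<in> \<A>"
    let ?X = "snd c ` (fst c \<inter> ?S)"
    note chart = oriented_surface_chart[OF S c]
    have X: "chart_inv c x \<in> fst c \<inter> ?S" "snd c (chart_inv c x) = x" if "x \<in> ?X" for x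
      using that chart_inv_in_Int[OF chart] chart_chart_inv[OF chart] by blast+
    have contG: "continuous_on ?X (\<lambda>x. G c (chart_inv c x) v)" for v
      unfolding G_def
      by (intro continuous_intros smooth_map_on_continuous[OF S g c]
          smooth_map_on_continuous[OF S smooth_map_on_subset[OF smooth_\<eta> ST] c])
    have contf: "continuous_on ?X (\<lambda>x. chart_deriv c f (chart_inv c x) v)" for v
      by (rule smooth_map_on_continuous[OF S smooth_map_on_subset[OF smooth_f ST] c])
    let ?Y = "?X \<times> {-\<epsilon><..<\<epsilon>}"
    have contG2: "continuous_on ?Y (\<lambda>y. G c (chart_inv c (fst y)) v)" for v
      by (rule continuous_on_compose2[OF contG]) (auto intro: continuous_intros)
    have contf2: "continuous_on ?Y (\<lambda>y. chart_deriv c f (chart_inv c (fst y)) v)" for v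
      by (rule continuous_on_compose2[OF contf]) (auto intro: continuous_intros)
    have contF2: "continuous_on ?Y (\<lambda>y. F (snd y) c (chart_inv c (fst y)) v)" for v
      unfolding F_def by (intro continuous_intros contG2 contf2)
    have sub: "?Y \<subseteq> snd c ` (fst c \<inter> W) \<times> {-\<epsilon><..<\<epsilon>}" using W by auto
    have contE2: "continuous_on ?Y (\<lambda>y. E (snd y) (chart_inv c (fst y)))"
      using continuous_on_subset[OF smooth_on_imp_continuous_on[OF EW[OF c]] sub]
      by (simp add: case_prod_unfold)
    have contE'2: "continuous_on ?Y (\<lambda>y. E' (snd y) c (chart_inv c (fst y)))"
      by (rule continuous_on_eq[OF continuous_on_subset[OF smooth_on_continuous_derivative[OF EW[OF c]] sub,
            of "(0, 1)"]]) (auto simp: E'_def X(2))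
    show "continuous_on ?Y (\<lambda>(x, t). w' t c (chart_inv c x))"
      unfolding w'_def case_prod_unfold
      by (intro continuous_intros continuous_on_cross contG2 contF2 contE2 contE'2)
    fix t assume t: "\<bar>t\<bar> < \<epsilon>"
    have contF: "continuous_on ?X (\<lambda>x. F t c (chart_inv c x) v)" for v
      unfolding F_def by (intro continuous_intros contG contf)
    have "continuous_on ?X (\<lambda>x. cross3 (F t c (chart_inv c x) (axis 1 1)) (F t c (chart_inv c x) (axis 2 1)) \<bullet>
        E t (chart_inv c x))"
    proof (intro continuous_intros continuous_on_cross contF)
      have "continuous_on ?X (\<lambda>x. (\<lambda>y. E (snd y) (chart_inv c (fst y))) (x, t))"
        by (rule continuous_on_compose2[OF contE2]) (use t in \<open>auto intro!: continuous_intros\<close>)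
      then show "continuous_on ?X (\<lambda>x. E t (chart_inv c x))" by simp
    qed
    then show "continuous_on ?X (\<lambda>x. ?w t c (chart_inv c x))"
      by (rule continuous_on_eq) (simp add: w[OF c X(1)])
  qed
  moreover have "form_integral T \<A> ?S (w' 0) = form_integral T \<A> ?S
      (\<lambda>c p. 2 * minkowski_mean_curvature \<A> f \<eta> p * g p * area_form f \<eta> c p)"
  proof (rule form_integral_cong[OF S K])
    fix c p assume c: "c \<in> \<A>" and p: "p \<in> fst c \<inter> ?S"
    then have pc: "p \<in> fst c" and pS: "p \<in> ?S" by auto
    let ?B = "chart_deriv c f p" and ?N = "chart_deriv c \<eta> p"
    note B = smooth_map_on_differentiable(3)[OF smooth_f c pc chart_topspace[OF c pc]]
    have "1 *\<^sub>R E' 0 c p \<in> range ?B"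
    proof (rule normal_derivative_tangent[OF norm B, where e = "\<lambda>t. E t p" and x = 0
          and e' = "\<lambda>s. s *\<^sub>R E' 0 c p"])
      show "inj ?B" "birkhoff_orthogonal \<nu> (E 0 p) (range ?B)"
        using birkhoff_normal_in_chart[OF c pc] E0[OF pS] by auto
      show "((\<lambda>t. E t p) has_derivative (\<lambda>s. s *\<^sub>R E' 0 c p)) (at 0)"
        using E'[OF c p, of 0] \<open>0 < \<epsilon>\<close> by (simp add: has_vector_derivative_def)
      show "open {-\<epsilon><..<\<epsilon>}" "0 \<in> {-\<epsilon><..<\<epsilon>}" using \<open>0 < \<epsilon>\<close> by auto
      show "\<nu> (E t p) = 1" if "t \<in> {-\<epsilon><..<\<epsilon>}" for t using E\<nu>[OF that pS] .
    qed
    then have "cross3 (?B (axis 1 1)) (?B (axis 2 1)) \<bullet> E' 0 c p = 0"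
      using range_eq_cross3_orthogonal[OF B birkhoff_normal_in_chart(1)[OF c pc]] by simp
    then have "w' 0 c p = g p * ((cross3 (?N (axis 1 1)) (?B (axis 2 1)) +
        cross3 (?B (axis 1 1)) (?N (axis 2 1))) \<bullet> \<eta> p)"
      by (simp add: w'_def F_def G_def E0[OF pS] cross_add_left cross_add_right cross_mult_left
          cross_mult_right inner_add_left dot_cross_self distrib_left)
    then show "w' 0 c p = 2 * minkowski_mean_curvature \<A> f \<eta> p * g p * area_form f \<eta> c p"
      by (simp add: mean_curvature_area_form[OF c pc])
  qed
  ultimately show ?thesis
    by (simp add: area_function_def[abs_def])
qed

section \<open>Parallel surfaces\<close>

text \<open>The product is a smooth expression in the first derivatives of \<open>f\<close> and \<open>\<eta>\<close> in one chart, whereas \<open>H\<close> is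
  defined pointwise through charts that may change from point to point.\<close>

lemma continuous_mean_curvature_form:
  assumes c: "c \<in> \<A>"
  shows "continuous_on (snd c ` fst c) (\<lambda>x. 2 * minkowski_mean_curvature \<A> f \<eta> (chart_inv c x) *
    area_form f \<eta> c (chart_inv c x))"
proof -
  note chart = oriented_surface_chart[OF S c]
  have eq: "fst c \<inter> topspace T = fst c" using chart_domain[OF chart] by auto
  note cont = smooth_map_on_continuous[OF S _ c, where X = "topspace T", unfolded eq]
  have "continuous_on (snd c ` fst c) (\<lambda>x.
     (cross3 (chart_deriv c \<eta> (chart_inv c x) (axis 1 1)) (chart_deriv c f (chart_inv c x) (axis 2 1)) +
      cross3 (chart_deriv c f (chart_inv c x) (axis 1 1)) (chart_deriv c \<eta> (chart_inv c x) (axis 2 1))) \<bullet>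
      \<eta> (chart_inv c x))"
    by (intro continuous_intros continuous_on_cross cont smooth_f smooth_\<eta>)
  then show ?thesis
    by (rule continuous_on_eq) (simp add: mean_curvature_area_form[OF c chart_inv_mem[OF chart]])
qed

text \<open>The determinant of \<open>\<partial>\<^sub>1f + t \<partial>\<^sub>1\<eta>\<close>, \<open>\<partial>\<^sub>2f + t \<partial>\<^sub>2\<eta>\<close> and \<open>\<eta>\<close> is continuous in the point and in \<open>t\<close> and does not
  vanish for \<open>t = 0\<close>; compactness makes the bound on \<open>t\<close> uniform.\<close>

lemma parallel_surfaces_immersed:
  assumes c: "c \<in> \<A>" and K: "compact K" "K \<subseteq> snd c ` fst c"
  shows "\<exists>\<epsilon>>0. \<forall>p\<in>chart_inv c ` K. \<forall>t. \<bar>t\<bar> < \<epsilon> \<longrightarrow>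
    inj (\<lambda>v. chart_deriv (chart_at \<A> p) f p v + t *\<^sub>R chart_deriv (chart_at \<A> p) \<eta> p v)"
proof -
  note chart = oriented_surface_chart[OF S c]
  have eq: "fst c \<inter> topspace T = fst c" using chart_domain[OF chart] by auto
  note cont = smooth_map_on_continuous[OF S _ c, where X = "topspace T", unfolded eq]
  define F where "F p t v = chart_deriv c f p v + t *\<^sub>R chart_deriv c \<eta> p v" for p t v
  define \<psi> where "\<psi> x t = cross3 (F (chart_inv c x) t (axis 1 1)) (F (chart_inv c x) t (axis 2 1)) \<bullet>
      \<eta> (chart_inv c x)" for x t
  have F2: "continuous_on (K \<times> {-1..1}) (\<lambda>y. F (chart_inv c (fst y)) (snd y) v)" for v
    unfolding F_def
    by (intro continuous_intros continuous_on_compose2[OF cont(2)[OF smooth_f], of _ fst]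
        continuous_on_compose2[OF cont(2)[OF smooth_\<eta>], of _ fst]) (use K in auto)
  have e2: "continuous_on (K \<times> {-1..1::real}) (\<lambda>y. \<eta> (chart_inv c (fst y)))"
    by (intro continuous_on_compose2[OF cont(1)[OF smooth_\<eta>], of _ fst] continuous_intros) (use K in auto)
  have \<psi>2: "continuous_on (K \<times> {-1..1}) (\<lambda>y. \<psi> (fst y) (snd y))"
    unfolding \<psi>_def by (intro continuous_intros continuous_on_cross F2 e2)
  then have unif: "uniformly_continuous_on (K \<times> {-1..1}) (\<lambda>y. \<psi> (fst y) (snd y))"
    using K(1) by (intro compact_uniformly_continuous compact_Times) auto
  have "continuous_on K (\<lambda>x. (\<lambda>y. \<psi> (fst y) (snd y)) (x, 0))"
    by (rule continuous_on_compose2[OF \<psi>2]) (auto intro!: continuous_intros)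
  then have cont0: "continuous_on K (\<lambda>x. \<bar>\<psi> x 0\<bar>)" by (auto intro: continuous_intros)
  have "\<psi> x 0 = area_form f \<eta> c (chart_inv c x)" for x
    by (simp add: \<psi>_def F_def area_form_eq_cross3)
  then have nz: "\<psi> x 0 \<noteq> 0" if "x \<in> K" for x
    using area_form_nonzero[OF c chart_inv_mem[OF chart]] that K(2) by auto
  have "\<exists>m>0. \<forall>x\<in>K. m \<le> \<bar>\<psi> x 0\<bar>"
  proof (cases "K = {}")
    case False
    from continuous_attains_inf[OF K(1) this cont0] obtain y
      where "y \<in> K" "\<forall>x\<in>K. \<bar>\<psi> y 0\<bar> \<le> \<bar>\<psi> x 0\<bar>" by blast
    with nz show ?thesis by (intro exI[of _ "\<bar>\<psi> y 0\<bar>"]) auto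
  qed (auto intro: exI[of _ 1])
  then obtain m where m: "m > 0" "\<And>x. x \<in> K \<Longrightarrow> m \<le> \<bar>\<psi> x 0\<bar>" by blast
  obtain \<delta> where \<delta>: "\<delta> > 0" "\<And>y z. y \<in> K \<times> {-1..1} \<Longrightarrow> z \<in> K \<times> {-1..1} \<Longrightarrow> dist z y < \<delta> \<Longrightarrow>
      dist (\<psi> (fst z) (snd z)) (\<psi> (fst y) (snd y)) < m"
    using unif m(1) unfolding uniformly_continuous_on_def by meson
  show ?thesis
  proof (intro exI conjI ballI allI impI)
    show "0 < min \<delta> 1" using \<delta> by simp
    fix p t assume "p \<in> chart_inv c ` K" and t: "\<bar>t\<bar> < min \<delta> 1"
    then obtain x where x: "x \<in> K" "p = chart_inv c x" by blast
    then have p: "p \<in> fst c" using K(2) chart_inv_mem[OF chart] by blast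
    note pT = chart_topspace[OF c p]
    have "dist (\<psi> x t) (\<psi> x 0) < m"
    proof -
      have "t \<in> {-1..1}" using t by auto
      then show ?thesis using \<delta>(2)[of "(x, 0)" "(x, t)"] x(1) t by (auto simp: dist_Pair_Pair)
    qed
    then have "\<psi> x t \<noteq> 0" using m(2)[OF x(1)] by (auto simp: dist_real_def)
    then have nz: "cross3 (F p t (axis 1 1)) (F p t (axis 2 1)) \<noteq> 0"
      by (auto simp: \<psi>_def x(2))
    have "linear (F p t)"
      unfolding F_def using smooth_map_on_differentiable(3)[OF smooth_f c p pT]
        smooth_map_on_differentiable(3)[OF smooth_\<eta> c p pT]
      by (intro linear_compose_add linear_compose_scale_right)
    then have inj: "inj (F p t)" using nz cross3_nonzero_iff_inj by blast
    let ?d = "chart_at \<A> p"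
    note d = chart_at[OF S pT]
    have "chart_deriv ?d h p = chart_deriv c h p \<circ> transition_deriv ?d c p"
      if "smooth_map_on T \<A> (topspace T) h" for h :: "'m \<Rightarrow> real^3"
      by (rule chart_deriv_transition(2)[OF S d(1) c d(2) p smooth_map_on_differentiable(2)[OF that c p pT]])
    then have "(\<lambda>v. chart_deriv ?d f p v + t *\<^sub>R chart_deriv ?d \<eta> p v) = F p t \<circ> transition_deriv ?d c p"
      using smooth_f smooth_\<eta> by (simp add: F_def fun_eq_iff)
    then show "inj (\<lambda>v. chart_deriv ?d f p v + t *\<^sub>R chart_deriv ?d \<eta> p v)"
      using inj_compose[OF inj transition_deriv_inj(2)[OF S d(1) c d(2) p]] by simp
  qed
qed

text \<open>For a constant function \<open>g\<close> the tangent planes of the varied surfaces are spanned by \<open>df + t g d\<eta>\<close>,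
  hence parallel to those of the original surface. The constant family \<open>\<eta>\<^sub>t = \<eta>\<close> therefore
  consists of their Birkhoff-Gauss maps and is smooth in \<open>t\<close>.\<close>

lemma parallel_variation:
  assumes D: "T closure_of D \<subseteq> topspace T" and "0 < \<epsilon>" and s: "\<bar>s\<bar> = 1"
    and inj: "\<And>p t. p \<in> T closure_of D \<Longrightarrow> \<bar>t\<bar> < \<epsilon> \<Longrightarrow>
      inj (\<lambda>v. chart_deriv (chart_at \<A> p) f p v + t *\<^sub>R chart_deriv (chart_at \<A> p) \<eta> p v)"
  shows "birkhoff_normal_variation \<nu> T \<A> f \<eta> D (\<lambda>_. s) \<epsilon> (\<lambda>_. \<eta>)"
proof -
  let ?S = "T closure_of D"
  have openU: "open (snd c ` fst c)" "fst c \<inter> topspace T = fst c" if "c \<in> \<A>" for c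
    using that chart_image_open chart_domain(2) oriented_surface_chart[OF S] by blast+
  have s_smooth: "smooth_map_on T \<A> (topspace T) (\<lambda>_. s)"
    unfolding smooth_map_on_def smooth_on_def comp_def
    using openU by (intro exI[of _ "topspace T"]) (auto intro: Ck_on_const)
  have F_smooth: "smooth_map_on T \<A> (topspace T) (variation_map f \<eta> (\<lambda>_. s) t)" for t
    unfolding smooth_map_on_def
  proof (intro exI conjI ballI)
    fix c assume c: "c \<in> \<A>"
    have eq: "variation_map f \<eta> (\<lambda>_. s) t \<circ> chart_inv c =
        (\<lambda>x. (f \<circ> chart_inv c) x + (t * s) *\<^sub>R (\<eta> \<circ> chart_inv c) x)"
      by (simp add: fun_eq_iff variation_map_def)
    have "Ck_on k (snd c ` fst c) (f \<circ> chart_inv c)" "Ck_on k (snd c ` fst c) (\<eta> \<circ> chart_inv c)" for k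
      using smooth_map_on_topspace_smooth_on[OF S _ c] smooth_f smooth_\<eta> by (auto simp: smooth_on_def)
    then show "smooth_on (snd c ` (fst c \<inter> topspace T)) (variation_map f \<eta> (\<lambda>_. s) t \<circ> chart_inv c)"
      unfolding smooth_on_def openU(2)[OF c] eq by (intro allI Ck_on_add_scaleR openU(1)[OF c])
  qed auto
  have deriv: "chart_deriv (chart_at \<A> p) (variation_map f \<eta> (\<lambda>_. s) t) p =
      (\<lambda>v. chart_deriv (chart_at \<A> p) f p v + (t * s) *\<^sub>R chart_deriv (chart_at \<A> p) \<eta> p v)"
    if "p \<in> topspace T" for p t
    using variation_map_deriv(1)[OF chart_at[OF S that] s_smooth that, of t]
    by (simp add: chart_deriv_def[of _ "\<lambda>_. s"] comp_def)
  show ?thesis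
    unfolding birkhoff_normal_variation_def
  proof (intro conjI ballI)
    show "smooth_map_on T \<A> ?S (\<lambda>_. s)" by (rule smooth_map_on_subset[OF s_smooth D])
    show "smooth_family_on T \<A> ?S \<epsilon> (\<lambda>_. \<eta>)"
      unfolding smooth_family_on_def
    proof (intro exI conjI ballI)
      fix c assume c: "c \<in> \<A>"
      show "smooth_on (snd c ` (fst c \<inter> topspace T) \<times> {-\<epsilon><..<\<epsilon>}) (\<lambda>(x, t). \<eta> (chart_inv c x))"
        using smooth_map_on_topspace_smooth_on[OF S smooth_\<eta> c]
        unfolding smooth_on_def openU(2)[OF c] comp_def
        by (simp add: Ck_on_fst openU(1)[OF c])
    qed (use D in auto)
    fix t assume "t \<in> {-\<epsilon><..<\<epsilon>}"
    then have ts: "\<bar>t * s\<bar> < \<epsilon>" using s by (auto simp: abs_mult)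
    show "immersion_on T \<A> ?S (variation_map f \<eta> (\<lambda>_. s) t)"
      unfolding immersion_on_def
    proof (intro conjI ballI)
      show "smooth_map_on T \<A> ?S (variation_map f \<eta> (\<lambda>_. s) t)"
        by (rule smooth_map_on_subset[OF F_smooth D])
      show "inj (chart_deriv (chart_at \<A> p) (variation_map f \<eta> (\<lambda>_. s) t) p)" if "p \<in> ?S" for p
        using inj[OF that ts] deriv[of p t] that D by auto
    qed
    show "birkhoff_gauss_map \<nu> T \<A> ?S (variation_map f \<eta> (\<lambda>_. s) t) \<eta>"
      unfolding birkhoff_gauss_map_def
    proof (intro conjI ballI)
      show "smooth_map_on T \<A> ?S \<eta>" by (rule smooth_map_on_subset[OF smooth_\<eta> D])
      fix p assume "p \<in> ?S"
      then have p: "p \<in> topspace T" using D by blast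
      note d = chart_at[OF S p]
      show "\<nu> (\<eta> p) = 1" by (rule \<nu>_\<eta>[OF p])
      have "tangent_plane \<A> (variation_map f \<eta> (\<lambda>_. s) t) p \<subseteq> tangent_plane \<A> f p"
        unfolding tangent_plane_def deriv[OF p]
      proof (intro image_subsetI)
        fix v
        note lin = smooth_map_on_differentiable(3)[OF smooth_f d p]
        show "chart_deriv (chart_at \<A> p) f p v + (t * s) *\<^sub>R chart_deriv (chart_at \<A> p) \<eta> p v
            \<in> range (chart_deriv (chart_at \<A> p) f p)"
          unfolding gauss_map_matrix[OF p]
          by (simp only: linear_add[OF lin, symmetric] linear_scale[OF lin, symmetric] rangeI)
      qed
      then show "birkhoff_orthogonal \<nu> (\<eta> p) (tangent_plane \<A> (variation_map f \<eta> (\<lambda>_. s) t) p)"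
        using gauss p birkhoff_orthogonal_mono by (auto simp: birkhoff_gauss_map_def)
    qed
  qed (use \<open>0 < \<epsilon>\<close> in auto)
qed

text \<open>Near a point with \<open>H \<noteq> 0\<close> the form \<open>H \<omega>\<close> has a constant sign. On a small coordinate disc, the
  constant function \<open>g = s\<close>, where \<open>s\<close> is that sign, makes the integrand of the first variation positive.\<close>

lemma nonzero_mean_curvature_variation:
  assumes p0: "p0 \<in> topspace T" and H: "minkowski_mean_curvature \<A> f \<eta> p0 \<noteq> 0"
  shows "\<exists>D g \<epsilon> E. surface_domain T D \<and> birkhoff_normal_variation \<nu> T \<A> f \<eta> D g \<epsilon> E \<and>
    0 < form_integral T \<A> (T closure_of D)
      (\<lambda>c p. 2 * minkowski_mean_curvature \<A> f \<eta> p * g p * area_form f \<eta> c p)"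
proof -
  let ?H = "minkowski_mean_curvature \<A> f \<eta>"
  define c where "c = chart_at \<A> p0"
  note c = chart_at[OF S p0, folded c_def]
  note chart = oriented_surface_chart[OF S c(1)]
  let ?U = "snd c ` fst c" and ?x0 = "snd c p0"
  define k where "k x = 2 * ?H (chart_inv c x) * area_form f \<eta> c (chart_inv c x)" for x
  define s where "s = sgn (k ?x0)"
  have "k ?x0 \<noteq> 0"
    using H area_form_nonzero[OF c] by (simp add: k_def chart_inv_chart[OF chart c(2)])
  then have s: "\<bar>s\<bar> = 1" "0 < s * k ?x0" by (simp_all add: s_def sgn_if)
  have "continuous_on ?U (\<lambda>x. s * k x)"
    unfolding k_def by (intro continuous_intros continuous_mean_curvature_form[OF c(1)])
  then have "open (?U \<inter> (\<lambda>x. s * k x) -` {0<..})"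
    using chart_image_open[OF chart] by (simp add: continuous_on_open_vimage Int_commute)
  moreover have "?x0 \<in> ?U \<inter> (\<lambda>x. s * k x) -` {0<..}" using s c(2) by auto
  ultimately obtain r where r: "0 < r" "cball ?x0 r \<subseteq> ?U \<inter> (\<lambda>x. s * k x) -` {0<..}"
    by (meson open_contains_cball)
  then have rU: "cball ?x0 r \<subseteq> ?U" by blast
  define D where "D = chart_inv c ` ball ?x0 r"
  note disc = coordinate_disc_domain[OF S c(1) r(1) rU, folded D_def]
  let ?S = "T closure_of D"
  have K: "compactin T ?S" and openD: "openin T D" using disc(2) by (auto simp: surface_domain_def)
  have ST: "?S \<subseteq> topspace T" by (rule closure_of_subset_topspace)
  obtain \<epsilon> where \<epsilon>: "\<epsilon> > 0" "\<And>p t. p \<in> ?S \<Longrightarrow> \<bar>t\<bar> < \<epsilon> \<Longrightarrow>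
      inj (\<lambda>v. chart_deriv (chart_at \<A> p) f p v + t *\<^sub>R chart_deriv (chart_at \<A> p) \<eta> p v)"
    using parallel_surfaces_immersed[OF c(1) compact_cball rU] unfolding disc(1) by blast
  have var: "birkhoff_normal_variation \<nu> T \<A> f \<eta> D (\<lambda>_. s) \<epsilon> (\<lambda>_. \<eta>)"
    by (rule parallel_variation[OF ST \<epsilon>(1) s(1) \<epsilon>(2)])
  have "0 < form_integral T \<A> ?S (\<lambda>c p. 2 * ?H p * s * area_form f \<eta> c p)"
  proof (rule form_integral_pos[OF S K openD])
    show "D \<noteq> {}" using r(1) by (simp add: D_def)
    show "D \<subseteq> ?S" using closure_of_subset[of D T] openin_subset[OF openD] by blast
    fix d assume d: "d \<in> \<A>"
    have "continuous_on (snd d ` (fst d \<inter> ?S)) (\<lambda>x. s * (2 * ?H (chart_inv d x) * area_form f \<eta> d (chart_inv d x)))"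
      by (intro continuous_intros continuous_on_subset[OF continuous_mean_curvature_form[OF d]]) auto
    then show "continuous_on (snd d ` (fst d \<inter> ?S)) (\<lambda>x. 2 * ?H (chart_inv d x) * s * area_form f \<eta> d (chart_inv d x))"
      by (simp add: ac_simps)
    fix p assume p: "p \<in> fst d \<inter> ?S"
    then obtain x where x: "x \<in> cball ?x0 r" "p = chart_inv c x" using disc(1) by auto
    have pc: "p \<in> fst c" using x rU chart_inv_mem[OF chart] by blast
    have "area_form f \<eta> d p = det (matrix (transition_deriv d c p)) * area_form f \<eta> c p"
      using p pc by (intro area_form_transition[OF S d c(1) _ _ smooth_f chart_topspace[OF c(1)]]) auto
    then have eq: "2 * ?H p * s * area_form f \<eta> d p = det (matrix (transition_deriv d c p)) * (s * k x)"
      by (simp add: k_def x(2))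
    have "0 < s * k x" using x(1) r(2) by auto
    moreover have "0 < det (matrix (transition_deriv d c p))"
      using p pc by (intro transition_deriv(2)[OF S d c(1)]) auto
    ultimately show "0 < 2 * ?H p * s * area_form f \<eta> d p" unfolding eq by (simp only: mult_pos_pos)
  qed
  with disc(2) var show ?thesis by blast
qed

end

section \<open>The variational characterization of minimal surfaces\<close>

theorem theorem2p1:
  fixes \<nu> :: "real^3 \<Rightarrow> real"
    and T :: "'m topology" and \<A> :: "'m chart set"
    and f \<eta> :: "'m \<Rightarrow> real^3"
  assumes "admissible_norm \<nu>"
    and "oriented_surface T \<A>"
    and "immersion_on T \<A> (topspace T) f"
    and "birkhoff_gauss_map \<nu> T \<A> (topspace T) f \<eta>"
    and "\<forall>p\<in>topspace T. minkowski_gauss_curvature \<A> f \<eta> p < 0"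
  shows "minimal_surface T \<A> f \<eta> \<longleftrightarrow>
    (\<forall>D g \<epsilon> E. surface_domain T D \<and> birkhoff_normal_variation \<nu> T \<A> f \<eta> D g \<epsilon> E \<longrightarrow>
       (area_function T \<A> f \<eta> D g E has_real_derivative 0) (at 0))"
proof -
  have norm: "is_norm \<nu>" using assms(1) by (simp add: admissible_norm_def)
  let ?I = "\<lambda>D g. form_integral T \<A> (T closure_of D)
      (\<lambda>c p. 2 * minkowski_mean_curvature \<A> f \<eta> p * g p * area_form f \<eta> c p)"
  have A': "(area_function T \<A> f \<eta> D g E has_real_derivative ?I D g) (at 0)"
    if "surface_domain T D" "birkhoff_normal_variation \<nu> T \<A> f \<eta> D g \<epsilon> E" for D g \<epsilon> E
    using first_variation[OF norm assms(2-4) that(2)] that(1) by (simp add: surface_domain_def)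
  show ?thesis
  proof (intro iffI allI impI)
    fix D g \<epsilon> E
    assume min: "minimal_surface T \<A> f \<eta>"
      and var: "surface_domain T D \<and> birkhoff_normal_variation \<nu> T \<A> f \<eta> D g \<epsilon> E"
    have K: "compactin T (T closure_of D)" using var by (simp add: surface_domain_def)
    have "?I D g = form_integral T \<A> (T closure_of D) (\<lambda>c :: 'm chart. \<lambda>p. 0)"
    proof (rule form_integral_cong[OF assms(2) K])
      fix c :: "'m chart" and p assume "p \<in> fst c \<inter> T closure_of D"
      then have "p \<in> topspace T" using closure_of_subset_topspace[of T D] by blast
      then show "2 * minkowski_mean_curvature \<A> f \<eta> p * g p * area_form f \<eta> c p = 0"
        using min by (simp add: minimal_surface_def)
    qed
    also have "\<dots> = 0" by (simp add: form_integral_def set_lebesgue_integral_def case_prod_unfold)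
    finally show "(area_function T \<A> f \<eta> D g E has_real_derivative 0) (at 0)"
      using A' var by metis
  next
    assume crit: "\<forall>D g \<epsilon> E. surface_domain T D \<and> birkhoff_normal_variation \<nu> T \<A> f \<eta> D g \<epsilon> E \<longrightarrow>
       (area_function T \<A> f \<eta> D g E has_real_derivative 0) (at 0)"
    show "minimal_surface T \<A> f \<eta>"
    proof (rule ccontr)
      assume "\<not> minimal_surface T \<A> f \<eta>"
      then obtain p0 where "p0 \<in> topspace T" "minkowski_mean_curvature \<A> f \<eta> p0 \<noteq> 0"
        by (auto simp: minimal_surface_def)
      from nonzero_mean_curvature_variation[OF norm assms(2-4) this] obtain D g \<epsilon> E
        where var: "surface_domain T D" "birkhoff_normal_variation \<nu> T \<A> f \<eta> D g \<epsilon> E"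
          and pos: "0 < ?I D g" by blast
      have "?I D g = 0" by (rule DERIV_unique[OF A'[OF var]]) (use crit var in blast)
      with pos show False by simp
    qed
  qed
qed

end
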